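(* Let $(P_n)_{n\in\mathbb{N}}$ be a sequence of nonconstant polynomials with complex coefficients, written as $P_n(z)=\sum_{j=m(n)}^{d(n)}c_{j,n}z^j$ with $m(n)\le d(n)$ and $c_{m(n),n}\neq 0\neq c_{d(n),n}$. Assume that: (a) the sequence $(m(n))_{n\in\mathbb{N}}$ of valences is unbounded; (b) at least one of the following three properties is satisfied: (P) there is an $\mathcal{E}$-unicity set $U\subset\mathbb{C}$ such that $\lim_{n\to\infty}|P_n(z)|=+\infty$ for all $z\in U$; (Q) for each $k\in\mathbb{N}$, $\lim_{n\to\infty}m(n)\,|c_{m(n),n}|^{k/m(n)}=+\infty$ and the sequence $\{c_{k+m(n),n}:n\in\mathbb{N}\}$ is bounded, where $c_{j,n}=0$ if $j>d(n)$ (here $m(n)\geq 1$ for all sufficiently large $n$, so that the expression in the limit is defined); (R) there is $r>0$ such that $\lim_{n\to\infty}\min\{|P_n(z)|:|z|=r\}=+\infty$. Then the set $HC((P_n(D)))$ is pointwise $\mathfrak{c}$-spaceable in $H(\mathbb{C})$, where $\mathfrak{c}$ is the cardinality of the continuum.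
   Context: $\mathbb{N}=\{1,2,3,\dots\}$. $H(\mathbb{C})$ is the Fréchet space of all entire functions with the topology of uniform convergence on compact sets. For a polynomial $P(z)=\sum_{j}c_jz^j$, $P(D)$ is the continuous linear operator on $H(\mathbb{C})$ given by $P(D)f=\sum_j c_j f^{(j)}$. The valence of a nonconstant polynomial $P(z)=\sum_{j=m}^d c_jz^j$ with $c_m\ne0\ne c_d$ is $m\in\mathbb{N}\cup\{0\}$ (the multiplicity at the origin). For a sequence $T_n:X\to Y$ of continuous linear mappings between topological vector spaces, $x_0\in X$ is hypercyclic for $(T_n)$ if $\{T_n(x_0):n\in\mathbb{N}\}$ is dense in $Y$; $HC((T_n))$ is the set of all vectors hypercyclic for $(T_n)$. $\mathcal{E}$ is the class of entire functions of exponential type, i.e. entire $\Phi$ for which there are positive constants $A,B$ with $|\Phi(z)|\le Ae^{B|z|}$ for all $z\in\mathbb{C}$. A set $U\subset\mathbb{C}$ is an $\mathcal{E}$-unicity set if every $f\in\mathcal{E}$ with $f(z)=0$ for all $z\in U$ satisfies $f\equiv0$. For a cardinal number $\alpha$, a subset $A$ of a topological vector space $X$ is pointwise $\alpha$-spaceable if for every $x\in A$ there is a closed vector subspace $W_x\subset X$ such that $\dim(W_x)=\alpha$ (algebraic dimension) and $x\in W_x\subset A\cup\{0\}$. *)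

theory Defs
  imports "HOL-Complex_Analysis.Complex_Analysis" "HOL-Library.Function_Algebras"
begin

unbundle cardinal_syntax

subsection \<open>The space of entire functions\<close>

(* H(C): functions f :: complex => complex that are holomorphic on UNIV.  The vector space
   operations are the pointwise ones (Function_Algebras and fun_scale). *)

definition fun_scale :: "complex \<Rightarrow> (complex \<Rightarrow> complex) \<Rightarrow> complex \<Rightarrow> complex" where
  "fun_scale c f = (\<lambda>z. c * f z)"

lemma vector_space_fun_scale: "vector_space fun_scale"
  by unfold_locales (auto simp: fun_scale_def fun_eq_iff algebra_simps)

definition compact_nbhd ::
    "(complex \<Rightarrow> complex) \<Rightarrow> complex set \<Rightarrow> real \<Rightarrow> (complex \<Rightarrow> complex) set" where
  "compact_nbhd f K e = {g. g holomorphic_on UNIV \<and> (\<forall>z\<in>K. dist (f z) (g z) < e)}"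

(* For continuous f and g and compact K, "dist (f z) (g z) < e for all z in K" is the same as
   "the supremum over K is less than e" (for e > 0). *)

definition open_in_entire :: "(complex \<Rightarrow> complex) set \<Rightarrow> bool" where
  "open_in_entire V \<longleftrightarrow>
     V \<subseteq> {f. f holomorphic_on UNIV} \<and>
     (\<forall>f\<in>V. \<exists>K e. compact K \<and> e > 0 \<and> compact_nbhd f K e \<subseteq> V)"

definition entire_space :: "(complex \<Rightarrow> complex) topology" where
  "entire_space = topology open_in_entire"

lemma istopology_open_in_entire: "istopology open_in_entire"
  unfolding istopology_def
proof (intro conjI allI impI)
  fix S T assume S: "open_in_entire S" and T: "open_in_entire T"
  have "S \<inter> T \<subseteq> {f. f holomorphic_on UNIV}"
    using S unfolding open_in_entire_def by (meson inf.coboundedI1)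
  moreover have "\<exists>K e. compact K \<and> e > 0 \<and> compact_nbhd f K e \<subseteq> S \<inter> T" if f: "f \<in> S \<inter> T" for f
  proof -
    obtain K d where K: "compact K" "d > 0" "compact_nbhd f K d \<subseteq> S"
      using S f unfolding open_in_entire_def by (meson IntD1)
    obtain L e where L: "compact L" "e > 0" "compact_nbhd f L e \<subseteq> T"
      using T f unfolding open_in_entire_def by (meson IntD2)
    have "compact_nbhd f (K \<union> L) (min d e) \<subseteq> compact_nbhd f K d"
         "compact_nbhd f (K \<union> L) (min d e) \<subseteq> compact_nbhd f L e"
      by (auto simp: compact_nbhd_def)
    then have "compact_nbhd f (K \<union> L) (min d e) \<subseteq> S \<inter> T"
      using K(3) L(3) by (meson Int_greatest subset_trans)
    moreover have "compact (K \<union> L)" "min d e > 0"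
      using K(1,2) L(1,2) by (simp_all add: compact_Un)
    ultimately show ?thesis by (intro exI conjI)
  qed
  ultimately show "open_in_entire (S \<inter> T)"
    unfolding open_in_entire_def by (intro conjI ballI)
next
  fix \<K> assume *: "\<forall>S\<in>\<K>. open_in_entire S"
  have "\<Union>\<K> \<subseteq> {f. f holomorphic_on UNIV}"
    using * unfolding open_in_entire_def by (meson Union_least)
  moreover have "\<exists>K e. compact K \<and> e > 0 \<and> compact_nbhd f K e \<subseteq> \<Union>\<K>"
    if f: "f \<in> \<Union>\<K>" for f
  proof -
    obtain S where S: "S \<in> \<K>" "f \<in> S" by (rule UnionE[OF f])
    have "open_in_entire S" using * S(1) by (rule bspec)
    then obtain K e where K: "compact K" "e > 0" "compact_nbhd f K e \<subseteq> S"
      using S(2) unfolding open_in_entire_def by meson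
    have "compact_nbhd f K e \<subseteq> \<Union>\<K>"
      using K(3) Union_upper[OF S(1)] by (rule subset_trans)
    with K(1,2) show ?thesis by (intro exI conjI)
  qed
  ultimately show "open_in_entire (\<Union>\<K>)"
    unfolding open_in_entire_def by (intro conjI ballI)
qed

lemma openin_entire_space: "openin entire_space = open_in_entire"
  unfolding entire_space_def using istopology_open_in_entire by (rule topology_inverse')

lemma topspace_entire_space: "topspace entire_space = {f. f holomorphic_on UNIV}"
proof
  show "topspace entire_space \<subseteq> {f. f holomorphic_on UNIV}"
    using openin_topspace[of entire_space]
    unfolding openin_entire_space open_in_entire_def by blast
  have "open_in_entire {f. f holomorphic_on UNIV}"
    unfolding open_in_entire_def
  proof (intro conjI ballI exI)
    fix f :: "complex \<Rightarrow> complex"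
    show "compact_nbhd f {} 1 \<subseteq> {f. f holomorphic_on UNIV}"
      by (auto simp: compact_nbhd_def)
  qed simp_all
  then show "{f. f holomorphic_on UNIV} \<subseteq> topspace entire_space"
    by (intro openin_subset) (simp add: openin_entire_space)
qed

subsection \<open>Hypercyclicity and spaceability\<close>

(* Sequences are indexed by {1, 2, ...}; the value at 0 is ignored. *)

definition hypercyclic_vectors ::
    "'a topology \<Rightarrow> 'b topology \<Rightarrow> (nat \<Rightarrow> 'a \<Rightarrow> 'b) \<Rightarrow> 'a set" where
  "hypercyclic_vectors X Y T =
     {x \<in> topspace X. Y closure_of {T n x | n. n \<ge> 1} = topspace Y}"

definition has_algebraic_dim ::
    "('k::field \<Rightarrow> 'a::ab_group_add \<Rightarrow> 'a) \<Rightarrow> 'a set \<Rightarrow> 'c rel \<Rightarrow> bool" where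
  "has_algebraic_dim scal W \<alpha> \<longleftrightarrow>
     (\<exists>B. \<not> module.dependent scal B \<and> module.span scal B = W \<and> |B| =o \<alpha>)"

(* The cardinal \<alpha> is given as a cardinal order, such as the one of a set S, written |S|. *)

definition pointwise_spaceable ::
    "('k::field \<Rightarrow> 'a::ab_group_add \<Rightarrow> 'a) \<Rightarrow> 'a topology \<Rightarrow> 'c rel \<Rightarrow> 'a set \<Rightarrow> bool" where
  "pointwise_spaceable scal X \<alpha> A \<longleftrightarrow>
     (\<forall>x\<in>A. \<exists>W. module.subspace scal W \<and> closedin X W \<and> has_algebraic_dim scal W \<alpha> \<and>
        x \<in> W \<and> W \<subseteq> A \<union> {0})"

subsection \<open>Polynomials, differential operators, exponential type\<close>

definition valence :: "complex poly \<Rightarrow> nat" where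
  "valence p = (LEAST j. coeff p j \<noteq> 0)"

definition diff_op :: "complex poly \<Rightarrow> (complex \<Rightarrow> complex) \<Rightarrow> complex \<Rightarrow> complex" where
  "diff_op p f = (\<lambda>z. \<Sum>j\<le>degree p. coeff p j * (deriv ^^ j) f z)"

definition exponential_type :: "(complex \<Rightarrow> complex) set" where
  "exponential_type =
     {\<Phi>. \<Phi> holomorphic_on UNIV \<and>
        (\<exists>A B. A > 0 \<and> B > 0 \<and> (\<forall>z. norm (\<Phi> z) \<le> A * exp (B * norm z)))}"

definition exp_unicity_set :: "complex set \<Rightarrow> bool" where
  "exp_unicity_set U \<longleftrightarrow>
     (\<forall>f\<in>exponential_type. (\<forall>z\<in>U. f z = 0) \<longrightarrow> (\<forall>z. f z = 0))"

definition property_P :: "(nat \<Rightarrow> complex poly) \<Rightarrow> bool" where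
  "property_P P \<longleftrightarrow>
     (\<exists>U. exp_unicity_set U \<and>
        (\<forall>z\<in>U. filterlim (\<lambda>n. norm (poly (P n) z)) at_top sequentially))"

(* coeff p j = 0 for j > degree p, which is the convention needed for the bounded sequence. *)

definition property_Q :: "(nat \<Rightarrow> complex poly) \<Rightarrow> bool" where
  "property_Q P \<longleftrightarrow>
     (\<forall>\<^sub>F n in sequentially. valence (P n) \<ge> 1) \<and>
     (\<forall>k\<ge>1.
        filterlim (\<lambda>n. real (valence (P n)) *
            norm (coeff (P n) (valence (P n))) powr (real k / real (valence (P n))))
          at_top sequentially \<and>
        bounded ((\<lambda>n. coeff (P n) (k + valence (P n))) ` {1..}))"

(* The infimum below is a minimum, since the circle is compact and nonempty. *)

definition property_R :: "(nat \<Rightarrow> complex poly) \<Rightarrow> bool" where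
  "property_R P \<longleftrightarrow>
     (\<exists>r>0. filterlim (\<lambda>n. INF z\<in>sphere 0 r. norm (poly (P n) z)) at_top sequentially)"

end

theory Submission
  imports Defs "HOL-Computational_Algebra.Fundamental_Theorem_Algebra"
begin

text \<open>
  Let \<open>x\<close> be hypercyclic for \<open>S n = P n (D)\<close>. Since the \<open>S n\<close> commute with all differential operators,
  \<open>S n (\<psi>(D) x) = \<psi>(D) (S n x)\<close>, and \<open>\<psi>(D)\<close> is surjective for \<open>\<psi> \<noteq> 0\<close>. Hence every \<open>\<psi>(D) x\<close> is
  hypercyclic, and the vectors \<open>\<psi>(D) x\<close> are dense, because the \<open>S n x\<close> already are. One can therefore
  choose \<open>f i = \<phi> i (D) x\<close> extremely close to monomials \<open>z ^ p i\<close>, with \<open>f 0\<close> a multiple of \<open>x\<close>. The closed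
  space \<open>W\<close> consists of all convergent series \<open>\<Sum>i. a i * f i\<close>; reading off the coefficients of
  \<open>z ^ p k\<close> recovers the \<open>a k\<close> with good estimates.

  The choice is recursive. By compactness a finite set \<open>N i\<close> of times suffices for
  \<open>\<Sum>k\<le>i. a k * S n (f k)\<close> to approximate the first \<open>i\<close> orbit points of \<open>x\<close>, for all \<open>a\<close> in a compact
  set that exhausts the nonzero sequences as \<open>i\<close> grows. The following \<open>p k\<close> are so large, and
  \<open>f k\<close> so close to \<open>z ^ p k\<close>, that \<open>S n\<close> with \<open>n \<in> N i\<close> hardly enlarges \<open>f k\<close> for \<open>k > i\<close>: it grows at most
  like \<open>(2 * norm z + 2) ^ p k\<close>, so the tail of the series is harmless.
\<close>

subsection \<open>Differential operators on entire functions\<close>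

text \<open>Padding with zero coefficients lets polynomials of different degrees share one summation
  range.\<close>

lemma diff_op_eq_sum:
  assumes "degree p \<le> N"
  shows "diff_op p f z = (\<Sum>j\<le>N. coeff p j * (deriv ^^ j) f z)"
  unfolding diff_op_def using assms
  by (intro sum.mono_neutral_left) (auto simp: coeff_eq_0)

lemma diff_op_holomorphic [holomorphic_intros]:
  assumes "f holomorphic_on UNIV"
  shows "diff_op p f holomorphic_on UNIV"
  unfolding diff_op_def using assms by (intro holomorphic_intros) auto

lemma diff_op_0_left [simp]: "diff_op 0 f = (\<lambda>z. 0)"
  by (simp add: diff_op_def)

lemma diff_op_add_left: "diff_op (p + q) f z = diff_op p f z + diff_op q f z"
  using diff_op_eq_sum[of "p + q" "max (degree p) (degree q)" f z]
    diff_op_eq_sum[of p "max (degree p) (degree q)" f z]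
    diff_op_eq_sum[of q "max (degree p) (degree q)" f z]
  by (simp add: degree_add_le_max sum.distrib algebra_simps)

lemma diff_op_smult_left: "diff_op (smult c p) f z = c * diff_op p f z"
  using diff_op_eq_sum[of "smult c p" "degree p" f z]
  by (simp add: diff_op_def degree_smult_le sum_distrib_left algebra_simps)

lemma diff_op_sum_left: "diff_op (\<Sum>i\<in>I. p i) f z = (\<Sum>i\<in>I. diff_op (p i) f z)"
  by (induction I rule: infinite_finite_induct) (auto simp: diff_op_add_left)

lemma diff_op_monom: "diff_op (monom c n) f z = c * (deriv ^^ n) f z"
proof -
  have "diff_op (monom c n) f z = (\<Sum>j\<le>n. coeff (monom c n) j * (deriv ^^ j) f z)"
    by (rule diff_op_eq_sum) (simp add: degree_monom_le)
  also have "\<dots> = (\<Sum>j\<in>{n}. coeff (monom c n) j * (deriv ^^ j) f z)"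
    by (intro sum.mono_neutral_right) auto
  finally show ?thesis by simp
qed

text \<open>Splitting off the constant term and shifting the index moves one derivative onto
  \<open>f\<close>; this recursion drives inductions over \<open>pCons\<close>.\<close>

lemma diff_op_pCons:
  "diff_op (pCons a p) f z = a * f z + diff_op p (deriv f) z"
proof -
  have "diff_op (pCons a p) f z = (\<Sum>j\<le>Suc (degree p). coeff (pCons a p) j * (deriv ^^ j) f z)"
    by (rule diff_op_eq_sum) (simp add: degree_pCons_le)
  also have "\<dots> = a * f z + diff_op p (deriv f) z"
    unfolding sum.atMost_Suc_shift
    by (simp add: diff_op_def funpow_swap1[of deriv] del: sum.atMost_Suc)
  finally show ?thesis .
qed

lemma diff_op_add_right:
  assumes "f holomorphic_on UNIV" "g holomorphic_on UNIV"
  shows "diff_op p (\<lambda>z. f z + g z) z = diff_op p f z + diff_op p g z"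
  using assms by (simp add: diff_op_def higher_deriv_add[of _ UNIV] sum.distrib algebra_simps)

lemma diff_op_cmult_right:
  assumes "f holomorphic_on UNIV"
  shows "diff_op p (\<lambda>z. c * f z) z = c * diff_op p f z"
  using assms by (simp add: diff_op_def higher_deriv_cmult[of _ UNIV] sum_distrib_left algebra_simps)

lemma diff_op_diff_right:
  assumes "f holomorphic_on UNIV" "g holomorphic_on UNIV"
  shows "diff_op p (\<lambda>z. f z - g z) z = diff_op p f z - diff_op p g z"
  using assms by (simp add: diff_op_def higher_deriv_diff[of _ UNIV] sum_subtractf algebra_simps)

lemma deriv_diff_op:
  assumes f: "f holomorphic_on UNIV"
  shows "deriv (diff_op p f) = diff_op p (deriv f)"
proof
  fix z
  have "((\<lambda>z. \<Sum>j\<le>degree p. coeff p j * (deriv ^^ j) f z) has_field_derivative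
      (\<Sum>j\<le>degree p. coeff p j * (deriv ^^ j) (deriv f) z)) (at z)"
    using has_field_derivative_higher_deriv[OF f, of z]
    by (intro DERIV_sum DERIV_cmult) (auto simp: funpow_swap1)
  then show "deriv (diff_op p f) z = diff_op p (deriv f) z"
    unfolding diff_op_def by (rule DERIV_imp_deriv)
qed

text \<open>Induction on \<open>p\<close> with \<open>f\<close> arbitrary, because the recursion
  passes from \<open>f\<close> to \<open>deriv f\<close>; \<open>deriv_diff_op\<close> carries the
  derivative past \<open>q(D)\<close>.\<close>

lemma diff_op_mult:
  assumes f: "f holomorphic_on UNIV"
  shows "diff_op (p * q) f z = diff_op p (diff_op q f) z"
  using f
proof (induction p arbitrary: f z)
  case 0
  show ?case by simp
next
  case (pCons a p)
  have "diff_op (pCons a p * q) f z = a * diff_op q f z + diff_op (p * q) (deriv f) z"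
    by (simp add: mult_pCons_left diff_op_add_left diff_op_smult_left diff_op_pCons)
  also have "diff_op (p * q) (deriv f) z = diff_op p (diff_op q (deriv f)) z"
    by (intro pCons.IH holomorphic_deriv pCons.prems) auto
  finally show ?case
    by (simp add: diff_op_pCons deriv_diff_op pCons.prems)
qed

lemma diff_op_commute:
  assumes "f holomorphic_on UNIV"
  shows "diff_op p (diff_op q f) = diff_op q (diff_op p f)"
  using diff_op_mult[OF assms, of p q] diff_op_mult[OF assms, of q p]
  by (auto simp: mult.commute fun_eq_iff)

text \<open>\<open>D - \<lambda>\<close> is inverted by the integrating factor \<open>exp (\<lambda> z)\<close>.\<close>
lemma diff_op_linear_surj:
  assumes g: "g holomorphic_on UNIV"
  shows "\<exists>h. h holomorphic_on UNIV \<and> diff_op [:-l, 1:] h = g"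
proof -
  have "(\<lambda>z. exp (- l * z) * g z) holomorphic_on UNIV"
    using g by (intro holomorphic_intros) auto
  from holomorphic_convex_primitive'[OF convex_UNIV open_UNIV this]
  obtain G where G: "\<And>z. z \<in> UNIV \<Longrightarrow> (G has_field_derivative exp (- l * z) * g z) (at z)"
    by blast
  define h where "h = (\<lambda>z. exp (l * z) * G z)"
  have h: "(h has_field_derivative l * h z + g z) (at z)" for z
  proof -
    have "(h has_field_derivative
        exp (l * z) * l * G z + exp (l * z) * (exp (- l * z) * g z)) (at z)"
      unfolding h_def by (rule derivative_eq_intros G[OF UNIV_I] refl | simp)+
    also have "exp (l * z) * l * G z + exp (l * z) * (exp (- l * z) * g z) = l * h z + g z"
      by (simp add: h_def exp_minus field_simps)
    finally show ?thesis .
  qed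
  then have "h holomorphic_on UNIV"
    using holomorphic_on_open by blast
  moreover have "diff_op [:-l, 1:] h = g"
    using DERIV_imp_deriv[OF h] by (simp add: fun_eq_iff diff_op_pCons)
  ultimately show ?thesis by blast
qed

text \<open>Over the complex numbers \<open>p\<close> splits into linear factors, which are inverted
  one after another. The leading coefficient is first divided out of the right-hand side.\<close>

lemma diff_op_surj:
  assumes "p \<noteq> 0" "g holomorphic_on UNIV"
  shows "\<exists>h. h holomorphic_on UNIV \<and> diff_op p h = g"
proof -
  obtain A where A: "p = smult (lead_coeff p) (\<Prod>x\<in>#A. [:-x, 1:])"
    using alg_closed_imp_factorization[OF assms(1)] by blast
  have "\<exists>h. h holomorphic_on UNIV \<and> diff_op (\<Prod>x\<in>#A. [:-x, 1:]) h = g"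
    if "g holomorphic_on UNIV" for g
    using that
  proof (induction A arbitrary: g)
    case empty
    have "diff_op 1 g = g"
      by (simp add: diff_op_def fun_eq_iff)
    with empty show ?case by auto
  next
    case (add l A)
    obtain g' where g': "g' holomorphic_on UNIV" "diff_op [:-l, 1:] g' = g"
      using diff_op_linear_surj[OF add.prems] by blast
    obtain h where h: "h holomorphic_on UNIV" "diff_op (\<Prod>x\<in>#A. [:-x, 1:]) h = g'"
      using add.IH[OF g'(1)] by blast
    have "diff_op (\<Prod>x\<in>#add_mset l A. [:-x, 1:]) h = diff_op [:-l, 1:] g'"
      unfolding h(2)[symmetric] image_mset_add_mset prod_mset.add_mset
      by (rule ext) (rule diff_op_mult[OF h(1)])
    then have "diff_op (\<Prod>x\<in>#add_mset l A. [:-x, 1:]) h = g"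
      by (simp only: g'(2))
    with h(1) show ?case by blast
  qed
  moreover have "(\<lambda>z. g z / lead_coeff p) holomorphic_on UNIV"
    using assms by (intro holomorphic_intros) auto
  ultimately obtain h where
    h: "h holomorphic_on UNIV" "diff_op (\<Prod>x\<in>#A. [:-x, 1:]) h = (\<lambda>z. g z / lead_coeff p)"
    by blast
  have "diff_op p h = g"
    by (subst A) (use h(2) assms(1) in \<open>auto simp: fun_eq_iff diff_op_smult_left\<close>)
  with h(1) show ?thesis by blast
qed

section \<open>Cauchy estimates for \<open>p(D)\<close> and for Taylor coefficients\<close>

text \<open>The weight \<open>fact j\<close> is the constant in Cauchy's inequality for the
  \<open>j\<close>-th derivative on a circle of radius 1. So this is a bound for the factor by which
  \<open>p(D)\<close> enlarges a function, at the price of shrinking the disc by 1.\<close>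

definition op_size :: "complex poly \<Rightarrow> real" where
  "op_size p = (\<Sum>j\<le>degree p. norm (coeff p j) * fact j)"

lemma op_size_nonneg: "op_size p \<ge> 0"
  by (simp add: op_size_def sum_nonneg)

lemma norm_higher_deriv_le:
  assumes "f holomorphic_on UNIV" "\<And>w. dist z w = 1 \<Longrightarrow> norm (f w) \<le> M"
  shows "norm ((deriv ^^ j) f z) \<le> fact j * M"
proof -
  have "norm ((deriv ^^ j) f z) \<le> fact j * M / 1 ^ j"
    by (intro Cauchy_inequality holomorphic_on_imp_continuous_on holomorphic_on_subset[OF assms(1)])
      (auto intro: assms(2) simp: dist_norm)
  then show ?thesis by simp
qed

lemma norm_diff_op_le:
  assumes "f holomorphic_on UNIV" "\<And>w. dist z w = 1 \<Longrightarrow> norm (f w) \<le> M"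
  shows "norm (diff_op p f z) \<le> op_size p * M"
proof -
  have "norm (diff_op p f z) \<le> (\<Sum>j\<le>degree p. norm (coeff p j * (deriv ^^ j) f z))"
    unfolding diff_op_def by (rule norm_sum)
  also have "\<dots> \<le> (\<Sum>j\<le>degree p. norm (coeff p j) * (fact j * M))"
    unfolding norm_mult
    by (intro sum_mono mult_left_mono norm_higher_deriv_le assms) auto
  finally show ?thesis by (simp add: op_size_def sum_distrib_right mult.assoc)
qed

lemma norm_diff_op_le_cball:
  assumes f: "f holomorphic_on UNIV" and "norm z \<le> r" "\<And>w. norm w \<le> r + 1 \<Longrightarrow> norm (f w) \<le> M"
  shows "norm (diff_op p f z) \<le> op_size p * M"
proof (rule norm_diff_op_le[OF f])
  fix w assume "dist z w = 1"
  then show "norm (f w) \<le> M"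
    using assms(2) norm_triangle_ineq2[of w z] by (intro assms(3)) (auto simp: dist_norm norm_minus_commute)
qed

definition taylor_coeff :: "nat \<Rightarrow> (complex \<Rightarrow> complex) \<Rightarrow> complex" where
  "taylor_coeff k f = (deriv ^^ k) f 0 / fact k"

lemma norm_taylor_coeff_le:
  assumes "f holomorphic_on UNIV" "r > 0" "\<And>z. norm z \<le> r \<Longrightarrow> norm (f z) \<le> M"
  shows "norm (taylor_coeff k f) \<le> M / r ^ k"
proof -
  have "norm ((deriv ^^ k) f 0) \<le> fact k * M / r ^ k"
    by (intro Cauchy_inequality holomorphic_on_imp_continuous_on holomorphic_on_subset[OF assms(1)])
      (use assms in auto)
  then show ?thesis by (simp add: taylor_coeff_def norm_divide field_simps)
qed

lemma taylor_coeff_diff: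
  assumes "f holomorphic_on UNIV" "g holomorphic_on UNIV"
  shows "taylor_coeff k (\<lambda>z. f z - g z) = taylor_coeff k f - taylor_coeff k g"
  using assms by (simp add: taylor_coeff_def higher_deriv_diff[of _ UNIV] diff_divide_distrib)

lemma taylor_coeff_power: "taylor_coeff k (\<lambda>z. z ^ n) = (if k = n then 1 else 0)"
proof -
  have *: "(deriv ^^ k) (\<lambda>z::complex. z ^ n) 0 = pochhammer (of_nat (Suc n - k)) k * 0 ^ (n - k)"
    using higher_deriv_power[of k 0 n "0::complex"] by simp
  consider "k < n" | "k = n" | "k > n" by linarith
  then show ?thesis
  proof cases
    case 2
    then show ?thesis
      unfolding taylor_coeff_def * by (simp add: pochhammer_fact[symmetric])
  next
    case 3
    then have "pochhammer (of_nat (Suc n - k)) k = (0::complex)"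
      by (simp add: pochhammer_0_left)
    with 3 * show ?thesis by (simp add: taylor_coeff_def)
  qed (simp add: taylor_coeff_def *)
qed

lemma entire_eq_0_if_taylor_coeff_0:
  assumes "\<And>k. taylor_coeff k f = 0" "f holomorphic_on UNIV"
  shows "f z = 0"
  using assms(1) holomorphic_fun_eq_0_on_ball[of f 0 "norm z + 1" z] assms(2)
  by (auto simp: taylor_coeff_def intro: holomorphic_on_subset)

section \<open>Termwise differentiation of normally convergent series\<close>

text \<open>A summable majorant on every disc gives uniform convergence there by the Weierstrass
  test. For holomorphic terms this passes to all derivatives, so \<open>p(D)\<close> and Taylor
  coefficients can be applied term by term.\<close>

locale normal_series =
  fixes h :: "nat \<Rightarrow> complex \<Rightarrow> complex"
  assumes hol: "\<And>i. h i holomorphic_on UNIV"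
    and normal: "\<And>r::real. \<exists>B. summable B \<and> (\<forall>i z. norm z \<le> r \<longrightarrow> norm (h i z) \<le> B i)"
begin

lemma uniform: "uniform_limit (cball 0 r) (\<lambda>n z. \<Sum>i<n. h i z) (\<lambda>z. \<Sum>i. h i z) sequentially"
proof -
  obtain B where "summable B" "\<And>i z. norm z \<le> r \<Longrightarrow> norm (h i z) \<le> B i"
    using normal[of r] by blast
  then show ?thesis by (intro Weierstrass_m_test[of _ h B]) auto
qed

lemma suminf_holomorphic: "(\<lambda>z. \<Sum>i. h i z) holomorphic_on UNIV"
proof (rule holomorphic_uniform_sequence)
  fix z :: complex
  have "cball z 1 \<subseteq> cball 0 (norm z + 1)"
    by (auto simp: dist_norm) (metis add.commute add_right_mono diff_add_cancel norm_minus_commute norm_triangle_le order_trans norm_triangle_ineq)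
  then have "uniform_limit (cball z 1) (\<lambda>n z. \<Sum>i<n. h i z) (\<lambda>z. \<Sum>i. h i z) sequentially"
    by (rule uniform_limit_on_subset[OF uniform])
  then show "\<exists>d>0. cball z d \<subseteq> UNIV \<and>
      uniform_limit (cball z d) (\<lambda>n z. \<Sum>i<n. h i z) (\<lambda>z. \<Sum>i. h i z) sequentially"
    by (intro exI[of _ 1]) auto
qed (auto intro!: holomorphic_intros hol)

lemma higher_deriv_sums: "(\<lambda>i. (deriv ^^ j) (h i) z) sums (deriv ^^ j) (\<lambda>z. \<Sum>i. h i z) z"
proof -
  have "(\<lambda>n. (deriv ^^ j) (\<lambda>z. \<Sum>i<n. h i z) z) \<longlonglongrightarrow> (deriv ^^ j) (\<lambda>z. \<Sum>i. h i z) z"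
    by (rule higher_deriv_complex_uniform_limit[where A = "ball 0 (norm z + 1)"])
      (auto intro!: uniform_limit_on_subset[OF uniform[of "norm z + 1"]] holomorphic_intros
        always_eventually holomorphic_on_subset[OF hol])
  moreover have "(deriv ^^ j) (\<lambda>z. \<Sum>i<n. h i z) z = (\<Sum>i<n. (deriv ^^ j) (h i) z)" for n
  proof (induction n)
    case 0
    have "(deriv ^^ j) (\<lambda>z::complex. 0::complex) z = 0"
      using higher_deriv_const[of j 0] by (simp add: fun_eq_iff)
    then show ?case by simp
  next
    case (Suc n)
    then show ?case
      using higher_deriv_add[of "\<lambda>z. \<Sum>i<n. h i z" UNIV "h n" z j]
      by (simp add: hol holomorphic_on_sum)
  qed
  ultimately show ?thesis by (simp add: sums_def)
qed

lemma diff_op_sums: "(\<lambda>i. diff_op p (h i) z) sums diff_op p (\<lambda>z. \<Sum>i. h i z) z"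
  unfolding diff_op_def by (intro sums_sum sums_mult higher_deriv_sums)

lemma taylor_coeff_sums: "(\<lambda>i. taylor_coeff k (h i)) sums taylor_coeff k (\<lambda>z. \<Sum>i. h i z)"
  unfolding taylor_coeff_def by (intro sums_divide higher_deriv_sums)

end

subsection \<open>Series of perturbed monomials\<close>

interpretation entire_vs: vector_space fun_scale
  by (rule vector_space_fun_scale)

section \<open>Cardinality and the algebraic dimension of the continuum\<close>

lemma entire_eqI_taylor:
  assumes "f holomorphic_on UNIV" "g holomorphic_on UNIV" "\<And>k. taylor_coeff k f = taylor_coeff k g"
  shows "f = g"
proof
  fix z
  have "f z - g z = 0"
    using assms by (intro entire_eq_0_if_taylor_coeff_0[of "\<lambda>z. f z - g z"])
      (auto simp: taylor_coeff_diff intro!: holomorphic_intros)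
  then show "f z = g z" by simp
qed

text \<open>An entire function is encoded by the rational cuts of the real and imaginary parts of
  its Taylor coefficients. Together these form a subset of a countable set, and the power set of the
  naturals is equipotent to the reals.\<close>

lemma lepoll_entire_reals: "{f. f holomorphic_on UNIV} \<lesssim> (UNIV :: real set)"
proof -
  define cut :: "(complex \<Rightarrow> complex) \<Rightarrow> (nat \<times> bool \<times> rat) set" where
    "cut f = {(k, b, q). of_rat q < (if b then Re (taylor_coeff k f) else Im (taylor_coeff k f))}" for f
  have rat_cut: "x = y" if "\<And>q. of_rat q < x \<longleftrightarrow> of_rat q < y" for x y :: real
    using that of_rat_dense[of x y] of_rat_dense[of y x] by (metis less_asym linorder_less_linear)
  have "inj_on cut {f. f holomorphic_on UNIV}"
  proof (rule inj_onI)
    fix f g assume fg: "f \<in> {f. f holomorphic_on UNIV}" "g \<in> {f. f holomorphic_on UNIV}" "cut f = cut g"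
    have "Re (taylor_coeff k f) = Re (taylor_coeff k g)" for k
    proof (rule rat_cut)
      fix q
      have "(k, True, q) \<in> cut f \<longleftrightarrow> (k, True, q) \<in> cut g" using fg(3) by simp
      then show "of_rat q < Re (taylor_coeff k f) \<longleftrightarrow> of_rat q < Re (taylor_coeff k g)"
        by (simp add: cut_def)
    qed
    moreover have "Im (taylor_coeff k f) = Im (taylor_coeff k g)" for k
    proof (rule rat_cut)
      fix q
      have "(k, False, q) \<in> cut f \<longleftrightarrow> (k, False, q) \<in> cut g" using fg(3) by simp
      then show "of_rat q < Im (taylor_coeff k f) \<longleftrightarrow> of_rat q < Im (taylor_coeff k g)"
        by (simp add: cut_def)
    qed
    ultimately show "f = g"
      using fg by (intro entire_eqI_taylor complex_eqI) auto
  qed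
  moreover have "inj_on (image (to_nat :: nat \<times> bool \<times> rat \<Rightarrow> nat)) X" for X
    by (meson inj_image_eq_iff inj_onI inj_to_nat)
  ultimately have "inj_on (image to_nat \<circ> cut) {f. f holomorphic_on UNIV}"
    by (intro comp_inj_on) auto
  then have "{f. f holomorphic_on UNIV} \<lesssim> (UNIV :: nat set set)"
    unfolding lepoll_def by blast
  then show ?thesis
    using nat_sets_eqpoll_reals lepoll_trans1 eqpoll_imp_lepoll lepoll_trans by blast
qed

text \<open>The independent set \<open>S\<close> extends to a Hamel basis of \<open>W\<close>. Its
  cardinality is squeezed between that of \<open>S\<close> and that of the set of all entire
  functions.\<close>

lemma has_algebraic_dim_continuum:
  assumes W: "entire_vs.subspace W" "W \<subseteq> {f. f holomorphic_on UNIV}"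
    and S: "S \<subseteq> W" "entire_vs.independent S" "(UNIV :: real set) \<lesssim> S"
  shows "has_algebraic_dim fun_scale W |UNIV :: real set|"
proof -
  obtain B where B: "S \<subseteq> B" "B \<subseteq> W" "entire_vs.independent B" "W \<subseteq> entire_vs.span B"
    using entire_vs.maximal_independent_subset_extend[OF S(1,2)] by blast
  have "B \<lesssim> (UNIV :: real set)"
    using B(2) W(2) lepoll_entire_reals by (meson lepoll_trans subset_imp_lepoll)
  moreover have "(UNIV :: real set) \<lesssim> B"
    using S(3) B(1) by (meson lepoll_trans subset_imp_lepoll)
  ultimately have "|B| =o |UNIV :: real set|"
    using lepoll_antisym eqpoll_iff_card_of_ordIso by blast
  moreover have "entire_vs.span B = W"
    using B(2,4) W(1) by (simp add: entire_vs.span_minimal subset_antisym)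
  ultimately show ?thesis
    unfolding has_algebraic_dim_def using B(3) by blast
qed

lemma entire_bounded:
  assumes "f holomorphic_on UNIV"
  shows "\<exists>M\<ge>0. \<forall>z. norm z \<le> r \<longrightarrow> norm (f z) \<le> M"
proof -
  have "compact (f ` cball 0 r)"
    using assms by (intro compact_continuous_image holomorphic_on_imp_continuous_on)
      (auto intro: holomorphic_on_subset)
  then obtain M where "\<forall>x\<in>f ` cball 0 r. norm x \<le> M"
    using compact_imp_bounded bounded_iff by blast
  then have "\<forall>z. norm z \<le> r \<longrightarrow> norm (f z) \<le> max M 0" by (auto simp: le_max_iff_disj)
  then show ?thesis by (meson max.cobounded2)
qed

section \<open>Perturbed monomials and their coefficient matrix\<close>

text \<open>The errors \<open>(1/2) ^ (i + 2)\<close> over all \<open>i\<close> add up to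
  \<open>1/2\<close>, which keeps the coefficient matrix invertible as a perturbation of the
  identity. The function \<open>f 0\<close> is to be a multiple of a given vector and need not be
  close to a monomial; only its coefficients at the exponents \<open>p k\<close> are controlled,
  with the error \<open>1/4\<close> that belongs to \<open>i = 0\<close>.\<close>

locale perturbed_monomials =
  fixes f :: "nat \<Rightarrow> complex \<Rightarrow> complex" and p :: "nat \<Rightarrow> nat"
  assumes hol: "\<And>i. f i holomorphic_on UNIV"
    and p: "strict_mono p"
    and close: "\<And>i z. i \<ge> 1 \<Longrightarrow> norm z \<le> real i \<Longrightarrow> norm (f i z - z ^ p i) \<le> (1/2) ^ (i + 2)"
    and coeff_0: "taylor_coeff (p 0) (f 0) = 1"
    and coeff_0': "\<And>k. k \<ge> 1 \<Longrightarrow> norm (taylor_coeff (p k) (f 0)) \<le> 1 / 4"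
begin

lemma p_ge: "k \<le> p k"
  using p by (rule strict_mono_imp_increasing)

lemma half_power_p: "(1/2::real) ^ p k \<le> (1/2) ^ k"
  using p_ge by (intro power_decreasing) auto

lemma p_eq_iff: "p i = p k \<longleftrightarrow> i = k"
  using p by (simp add: strict_mono_eq)

text \<open>On a fixed disc \<open>close\<close> covers all large \<open>i\<close>. The finitely
  many remaining indices, among them 0, are bounded by compactness.\<close>

lemma error_bound:
  obtains B where "summable B" "\<And>i. B i \<ge> 0"
    "\<And>i z. norm z \<le> r \<Longrightarrow> norm (f i z - z ^ p i) \<le> B i"
proof -
  define N where "N = nat \<lceil>r\<rceil> + 1"
  have "\<exists>M\<ge>0. \<forall>z. norm z \<le> r \<longrightarrow> norm (f i z - z ^ p i) \<le> M" for i
    by (rule entire_bounded) (intro holomorphic_intros hol)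
  then obtain M where M: "\<And>i. M i \<ge> 0" "\<And>i z. norm z \<le> r \<Longrightarrow> norm (f i z - z ^ p i) \<le> M i"
    by metis
  define B where "B = (\<lambda>i. if i < N then M i else (1/2) ^ (i + 2))"
  have "eventually (\<lambda>i. B i = (1/2) ^ i * (1/4)) sequentially"
    using eventually_ge_at_top[of N] by eventually_elim (simp add: B_def power_add power2_eq_square)
  moreover have "summable (\<lambda>i. (1/2::real) ^ i * (1/4))"
    by (intro summable_mult2 summable_geometric) auto
  ultimately have "summable B"
    by (simp only: summable_cong)
  moreover have "norm (f i z - z ^ p i) \<le> B i" if "norm z \<le> r" for i z
  proof (cases "i < N")
    case False
    then have "r \<le> real i" "i \<ge> 1" by (auto simp: N_def) linarith
    with close[of i z] that False show ?thesis by (simp add: B_def)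
  qed (use M(2)[OF that] in \<open>simp add: B_def\<close>)
  moreover have "B i \<ge> 0" for i using M(1) by (simp add: B_def)
  ultimately show ?thesis using that by blast
qed

text \<open>Entry \<open>(k, i)\<close> of the coefficient matrix of the \<open>f i\<close> at the
  exponents \<open>p k\<close>, minus the identity matrix.\<close>

definition coord_error :: "nat \<Rightarrow> nat \<Rightarrow> complex" where
  "coord_error k i = taylor_coeff (p k) (f i) - (if k = i then 1 else 0)"

text \<open>Since \<open>p\<close> is injective, the monomial \<open>z ^ p i\<close> contributes
  exactly the identity matrix. What remains is a Taylor coefficient of the error
  \<open>f i z - z ^ p i\<close>, to which Cauchy's estimate applies.\<close>

lemma coord_error_le_gen:
  assumes "r > 0" "\<And>z. norm z \<le> r \<Longrightarrow> norm (f i z - z ^ p i) \<le> b"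
  shows "norm (coord_error k i) \<le> b / r ^ p k"
proof -
  have "coord_error k i = taylor_coeff (p k) (\<lambda>z. f i z - z ^ p i)"
    by (subst taylor_coeff_diff)
      (auto intro!: holomorphic_intros hol simp: taylor_coeff_power coord_error_def p_eq_iff)
  then show ?thesis
    using assms by (auto intro!: norm_taylor_coeff_le holomorphic_intros hol)
qed

lemma coord_error_le: "norm (coord_error k i) \<le> (1/2) ^ (i + 2)"
proof (cases "i = 0")
  case True
  then show ?thesis
    using coeff_0 coeff_0'[of k] by (cases "k = 0") (auto simp: coord_error_def power2_eq_square)
next
  case False
  then show ?thesis
    using coord_error_le_gen[of 1 i "(1/2) ^ (i + 2)" k] close[of i] by simp
qed

section \<open>Coordinate sequences and their combinations\<close>

text \<open>These are the sequences for which the lacunary power series with terms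
  \<open>a k * z ^ p k\<close> is entire.\<close>

definition coords :: "(nat \<Rightarrow> complex) set" where
  "coords = {a. \<forall>r\<ge>0. summable (\<lambda>k. norm (a k) * r ^ p k)}"

definition comb :: "(nat \<Rightarrow> complex) \<Rightarrow> complex \<Rightarrow> complex" where
  "comb a = (\<lambda>z. \<Sum>i. a i * f i z)"

lemma coordsD: "a \<in> coords \<Longrightarrow> r \<ge> 0 \<Longrightarrow> summable (\<lambda>k. norm (a k) * r ^ p k)"
  by (simp add: coords_def)

lemma coords_summable: "a \<in> coords \<Longrightarrow> summable (\<lambda>k. norm (a k))"
  using coordsD[of a 1] by simp

lemma coords_bounded:
  assumes "a \<in> coords"
  shows "bdd_above (range (\<lambda>k. norm (a k)))"
  using coords_summable[OF assms]
  by (meson summable_LIMSEQ_zero convergentI convergent_imp_Bseq Bseq_bdd_above)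

lemma coords_diff:
  assumes "a \<in> coords" "b \<in> coords"
  shows "(\<lambda>k. a k - b k) \<in> coords"
  unfolding coords_def
proof (intro CollectI allI impI)
  fix r :: real assume r: "r \<ge> 0"
  show "summable (\<lambda>k. norm (a k - b k) * r ^ p k)"
  proof (rule summable_comparison_test')
    show "summable (\<lambda>k. norm (a k) * r ^ p k + norm (b k) * r ^ p k)"
      using assms r by (intro summable_add coordsD)
    show "norm (norm (a k - b k) * r ^ p k) \<le> norm (a k) * r ^ p k + norm (b k) * r ^ p k" for k
      using r norm_triangle_ineq4[of "a k" "b k"]
      by (simp flip: distrib_right add: mult_right_mono)
  qed
qed

lemma coords_cmult:
  assumes "a \<in> coords"
  shows "(\<lambda>k. c * a k) \<in> coords"
  using assms by (auto simp: coords_def norm_mult mult.assoc intro: summable_mult)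

lemma coords_0: "(\<lambda>k. 0) \<in> coords"
  by (simp add: coords_def)

lemma coords_add:
  assumes "a \<in> coords" "b \<in> coords"
  shows "(\<lambda>k. a k + b k) \<in> coords"
  using coords_diff[OF assms(1) coords_cmult[OF assms(2), of "-1"]] by simp

text \<open>The majorant has two parts: the monomials contribute
  \<open>norm (a i) * \<bar>r\<bar> ^ p i\<close>, summable by definition of \<open>coords\<close>,
  and the errors contribute the supremum of the coordinates times the bounds of
  \<open>error_bound\<close>.\<close>

lemma normal_series:
  assumes a: "a \<in> coords"
  shows "normal_series (\<lambda>i z. a i * f i z)"
proof
  fix r :: real
  obtain B where B: "summable B" "\<And>i. B i \<ge> 0"
    "\<And>i z. norm z \<le> \<bar>r\<bar> \<Longrightarrow> norm (f i z - z ^ p i) \<le> B i"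
    using error_bound by blast
  obtain M where M: "\<And>k. norm (a k) \<le> M"
    using coords_bounded[OF a] by (auto simp: bdd_above_def)
  have "norm (a i * f i z) \<le> norm (a i) * \<bar>r\<bar> ^ p i + M * B i" if z: "norm z \<le> r" for i z
  proof -
    have "norm (f i z) \<le> norm (z ^ p i) + norm (f i z - z ^ p i)"
      using norm_triangle_ineq[of "z ^ p i" "f i z - z ^ p i"] by simp
    also have "\<dots> \<le> \<bar>r\<bar> ^ p i + B i"
      using z by (intro add_mono B(3)) (auto simp: norm_power intro!: power_mono)
    finally have "norm (a i) * norm (f i z) \<le> norm (a i) * (\<bar>r\<bar> ^ p i + B i)"
      by (rule mult_left_mono) simp
    also have "\<dots> \<le> norm (a i) * \<bar>r\<bar> ^ p i + M * B i"
      using M[of i] B(2)[of i] by (simp add: distrib_left mult_right_mono)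
    finally show ?thesis by (simp add: norm_mult)
  qed
  moreover have "summable (\<lambda>i. norm (a i) * \<bar>r\<bar> ^ p i + M * B i)"
    using a B(1) by (intro summable_add summable_mult coordsD) auto
  ultimately show "\<exists>B. summable B \<and> (\<forall>i z. norm z \<le> r \<longrightarrow> norm (a i * f i z) \<le> B i)"
    by blast
qed (intro holomorphic_intros hol)

lemma comb_holomorphic: "a \<in> coords \<Longrightarrow> comb a holomorphic_on UNIV"
  unfolding comb_def by (intro normal_series.suminf_holomorphic normal_series)

lemma comb_sums: "a \<in> coords \<Longrightarrow> (\<lambda>i. a i * f i z) sums comb a z"
  using normal_series.higher_deriv_sums[OF normal_series, of a 0 z] by (simp add: comb_def)

lemma diff_op_comb_sums:
  assumes "a \<in> coords"
  shows "(\<lambda>i. a i * diff_op q (f i) z) sums diff_op q (comb a) z"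
  using normal_series.diff_op_sums[OF normal_series[OF assms], of q z]
  by (simp add: comb_def diff_op_cmult_right hol)

lemma comb_diff:
  assumes "a \<in> coords" "b \<in> coords"
  shows "comb (\<lambda>k. a k - b k) z = comb a z - comb b z"
  using sums_diff[OF comb_sums[OF assms(1)] comb_sums[OF assms(2)], of z]
    comb_sums[OF coords_diff[OF assms], of z]
  by (simp add: left_diff_distrib sums_unique2)

lemma comb_add:
  assumes "a \<in> coords" "b \<in> coords"
  shows "comb (\<lambda>k. a k + b k) z = comb a z + comb b z"
  using sums_add[OF comb_sums[OF assms(1)] comb_sums[OF assms(2)], of z]
    comb_sums[OF coords_add[OF assms], of z]
  by (simp add: distrib_right sums_unique2)

lemma comb_cmult:
  assumes "a \<in> coords"
  shows "comb (\<lambda>k. c * a k) z = c * comb a z"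
  using sums_mult[OF comb_sums[OF assms], of c z] comb_sums[OF coords_cmult[OF assms], of c z]
  by (simp add: mult.assoc sums_unique2)

lemma comb_0: "comb (\<lambda>k. 0) = (\<lambda>z. 0)"
  by (simp add: comb_def)

section \<open>Estimates between coordinates and combinations\<close>

text \<open>Taking the coefficient termwise and subtracting the identity part leaves the sum of
  \<open>a i * coord_error k i\<close>.\<close>

lemma taylor_coeff_comb_near_coord:
  assumes a: "a \<in> coords" and s: "\<And>i. norm (a i) \<le> s"
    and b: "summable b" "\<And>i. norm (coord_error k i) \<le> b i"
  shows "norm (taylor_coeff (p k) (comb a) - a k) \<le> s * suminf b"
proof -
  have "(\<lambda>i. taylor_coeff (p k) (\<lambda>z. a i * f i z)) sums taylor_coeff (p k) (comb a)"
    unfolding comb_def by (intro normal_series.taylor_coeff_sums normal_series a)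
  moreover have "taylor_coeff (p k) (\<lambda>z. a i * f i z) = a i * taylor_coeff (p k) (f i)" for i
    by (simp add: taylor_coeff_def higher_deriv_cmult[of _ UNIV] hol)
  moreover have "(\<lambda>i. if i = k then a i else 0) sums a k"
    using sums_single[of k a] by simp
  ultimately have "(\<lambda>i. a i * taylor_coeff (p k) (f i) - (if i = k then a i else 0)) sums
      (taylor_coeff (p k) (comb a) - a k)"
    by (auto intro!: sums_diff)
  also have "(\<lambda>i. a i * taylor_coeff (p k) (f i) - (if i = k then a i else 0)) =
      (\<lambda>i. a i * coord_error k i)"
    by (auto simp: coord_error_def algebra_simps fun_eq_iff)
  finally have sums: "(\<lambda>i. a i * coord_error k i) sums (taylor_coeff (p k) (comb a) - a k)" .
  have "s \<ge> 0" using s[of 0] norm_ge_zero order_trans by blast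
  then have le: "norm (a i * coord_error k i) \<le> s * b i" for i
    unfolding norm_mult using s[of i] b(2)[of i] by (intro mult_mono) auto
  have "norm (\<Sum>i. a i * coord_error k i) \<le> (\<Sum>i. s * b i)"
    by (rule norm_suminf_le[OF le]) (use b(1) in \<open>rule summable_mult\<close>)
  also have "\<dots> = s * suminf b" using b(1) by (rule suminf_mult)
  finally show ?thesis using sums_unique[OF sums] by simp
qed

text \<open>Two passes. The unit-scale error sum \<open>1/2\<close> first yields a uniform bound for
  the coordinates; with this bound, Cauchy's estimate on radius \<open>r\<close> then recovers the
  weight \<open>r ^ p k\<close>.\<close>

lemma coords_le_comb:
  fixes r :: real
  assumes r: "r \<ge> 1"
  shows "\<exists>C>0. \<forall>a\<in>coords. \<forall>M. (\<forall>z. norm z \<le> r \<longrightarrow> norm (comb a z) \<le> M) \<longrightarrow>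
    (\<forall>k. norm (a k) * r ^ p k \<le> C * M)"
proof -
  obtain B where B: "summable B" "\<And>i. B i \<ge> 0"
    "\<And>i z. norm z \<le> r \<Longrightarrow> norm (f i z - z ^ p i) \<le> B i"
    using error_bound by blast
  have B0: "suminf B \<ge> 0" using B(1,2) by (simp add: suminf_nonneg)
  show ?thesis
  proof (intro exI[of _ "1 + 2 * suminf B"] conjI ballI allI impI)
    show "1 + 2 * suminf B > 0" using B0 by simp
    fix a M k
    assume a: "a \<in> coords" and M: "\<forall>z. norm z \<le> r \<longrightarrow> norm (comb a z) \<le> M"
    have rp: "r ^ p k \<ge> 1" for k using r by simp
    have "norm (comb a 0) \<le> M" using M r by simp
    then have M0: "M \<ge> 0" using norm_ge_zero order_trans by blast
    have tc: "norm (taylor_coeff (p k) (comb a)) \<le> M / r ^ p k" for k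
      using a r M by (intro norm_taylor_coeff_le comb_holomorphic) auto
    define s where "s = (SUP k. norm (a k))"
    have s: "norm (a i) \<le> s" for i
      unfolding s_def using coords_bounded[OF a] by (intro cSUP_upper) auto
    have geo: "(\<lambda>i. (1/2::real) ^ (i + 2)) sums (1/2)"
      using sums_mult2[OF geometric_sums[of "1/2::real"], of "1/4"] by (simp add: power_add power2_eq_square)
    have "norm (a k) \<le> M + s * (1/2)" for k
    proof -
      have "norm (taylor_coeff (p k) (comb a) - a k) \<le> s * (1/2)"
        using taylor_coeff_comb_near_coord[OF a s, of "\<lambda>i. (1/2) ^ (i + 2)" k] geo
        by (metis coord_error_le sums_iff)
      moreover have "M / r ^ p k \<le> M"
        using rp[of k] M0 by (simp add: divide_le_eq mult_left_le mult_le_cancel_left1)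
      ultimately show ?thesis
        using tc[of k] norm_triangle_ineq2[of "a k" "taylor_coeff (p k) (comb a)"]
        by (simp add: norm_minus_commute)
    qed
    \<comment> \<open>The supremum \<open>s\<close> is finite, so the half of it on the right can be
      absorbed, which gives \<open>s \<le> 2 * M\<close>.\<close>
    then have "s \<le> M + s * (1/2)"
      unfolding s_def by (intro cSUP_least) auto
    then have s2: "norm (a i) \<le> 2 * M" for i using s[of i] by linarith
    have "summable (\<lambda>i. B i / r ^ p k)" using B(1) by (rule summable_divide)
    then have "norm (taylor_coeff (p k) (comb a) - a k) \<le> 2 * M * (\<Sum>i. B i / r ^ p k)"
      by (intro taylor_coeff_comb_near_coord[OF a s2] coord_error_le_gen B(3)) (use r in auto)
    also have "(\<Sum>i. B i / r ^ p k) = suminf B / r ^ p k"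
      using B(1) by (rule suminf_divide)
    finally have "norm (a k) \<le> M / r ^ p k + 2 * M * (suminf B / r ^ p k)"
      using tc[of k] norm_triangle_ineq2[of "a k" "taylor_coeff (p k) (comb a)"]
      by (simp add: norm_minus_commute)
    then have "norm (a k) * r ^ p k \<le> (M / r ^ p k + 2 * M * (suminf B / r ^ p k)) * r ^ p k"
      using r by (intro mult_right_mono) auto
    also have "\<dots> = (1 + 2 * suminf B) * M"
      using r by (simp add: field_simps)
    finally show "norm (a k) * r ^ p k \<le> (1 + 2 * suminf B) * M" .
  qed
qed

text \<open>Converse estimate. The weight \<open>2 * r\<close> in place of \<open>r\<close> leaves a
  factor \<open>(1/2) ^ p i\<close> on the monomials, which makes the sum converge;
  \<open>r \<ge> 1\<close> keeps the weights at least 1, so that the error terms are not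
  enlarged.\<close>

lemma comb_le_coords:
  fixes r :: real
  assumes r: "r \<ge> 1"
  shows "\<exists>C>0. \<forall>a\<in>coords. \<forall>e. (\<forall>k. norm (a k) * (2 * r) ^ p k \<le> e) \<longrightarrow>
    (\<forall>z. norm z \<le> r \<longrightarrow> norm (comb a z) \<le> C * e)"
proof -
  obtain B where B: "summable B" "\<And>i. B i \<ge> 0"
    "\<And>i z. norm z \<le> r \<Longrightarrow> norm (f i z - z ^ p i) \<le> B i"
    using error_bound by blast
  have B0: "suminf B \<ge> 0" using B(1,2) by (simp add: suminf_nonneg)
  show ?thesis
  proof (intro exI[of _ "2 + suminf B"] conjI ballI allI impI)
    show "2 + suminf B > 0" using B0 by simp
    fix a e and z :: complex
    assume a: "a \<in> coords" and e: "\<forall>k. norm (a k) * (2 * r) ^ p k \<le> e" and z: "norm z \<le> r"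
    have "norm (a 0) * (2 * r) ^ p 0 \<ge> 0" using r by simp
    then have e0: "e \<ge> 0" using e order_trans by blast
    have le: "norm (a i * f i z) \<le> ((1/2) ^ i + B i) * e" for i
    proof -
      have "norm (f i z) \<le> norm (z ^ p i) + norm (f i z - z ^ p i)"
        using norm_triangle_ineq[of "z ^ p i" "f i z - z ^ p i"] by simp
      also have "\<dots> \<le> r ^ p i + B i"
        using z by (intro add_mono B(3)) (auto simp: norm_power intro!: power_mono)
      finally have "norm (a i * f i z) \<le> norm (a i) * (r ^ p i + B i)"
        unfolding norm_mult by (rule mult_left_mono) simp
      also have "norm (a i) \<le> e / (2 * r) ^ p i"
        using e[rule_format, of i] r by (simp add: pos_le_divide_eq)
      then have "norm (a i) * (r ^ p i + B i) \<le> e / (2 * r) ^ p i * (r ^ p i + B i)"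
        using r B(2)[of i] by (intro mult_right_mono) auto
      also have "\<dots> = e * (1/2) ^ p i + e * (B i / (2 * r) ^ p i)"
        using r by (simp add: field_simps power_mult_distrib)
      also have "\<dots> \<le> e * (1/2) ^ i + e * B i"
      proof (intro add_mono mult_left_mono half_power_p e0)
        have "(2 * r) ^ p i \<ge> 1" using r by (intro one_le_power) simp
        then show "B i / (2 * r) ^ p i \<le> B i"
          using B(2)[of i] by (simp add: divide_le_eq mult_le_cancel_left1)
      qed
      finally show ?thesis by (simp add: algebra_simps)
    qed
    have geo: "(\<lambda>i. (1/2::real) ^ i) sums 2"
      using geometric_sums[of "1/2::real"] by simp
    have sums: "(\<lambda>i. ((1/2) ^ i + B i) * e) sums ((2 + suminf B) * e)"
      by (intro sums_mult2 sums_add geo summable_sums B(1))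
    have "norm (\<Sum>i. a i * f i z) \<le> (\<Sum>i. ((1/2) ^ i + B i) * e)"
      by (rule norm_suminf_le[OF le]) (rule sums_summable[OF sums])
    then show "norm (comb a z) \<le> (2 + suminf B) * e"
      using sums_unique[OF sums] by (simp add: comb_def)
  qed
qed

lemma comb_eq_0_iff:
  assumes "a \<in> coords"
  shows "comb a = (\<lambda>z. 0) \<longleftrightarrow> a = (\<lambda>k. 0)"
proof
  assume 0: "comb a = (\<lambda>z. 0)"
  obtain C where C: "\<forall>a\<in>coords. \<forall>M. (\<forall>z. norm z \<le> 1 \<longrightarrow> norm (comb a z) \<le> M) \<longrightarrow>
      (\<forall>k. norm (a k) * 1 ^ p k \<le> C * M)"
    using coords_le_comb[of 1] by auto
  have "norm (a k) * 1 ^ p k \<le> C * 0" for k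
    using C[rule_format, OF assms, of 0] 0 by simp
  then show "a = (\<lambda>k. 0)" by (simp add: fun_eq_iff)
qed (simp add: comb_0)

section \<open>The closed subspace of all combinations\<close>

lemma subspace_comb: "entire_vs.subspace (comb ` coords)"
  unfolding entire_vs.subspace_def
proof (intro conjI ballI allI)
  show "0 \<in> comb ` coords"
    using comb_0 coords_0 by (auto simp: zero_fun_def intro!: image_eqI[of _ _ "\<lambda>k. 0"])
  fix x y assume "x \<in> comb ` coords" "y \<in> comb ` coords"
  then obtain a b where "a \<in> coords" "b \<in> coords" "x = comb a" "y = comb b" by blast
  then show "x + y \<in> comb ` coords"
    by (intro image_eqI[of _ _ "\<lambda>k. a k + b k"]) (auto simp: comb_add coords_add fun_eq_iff)
next
  fix x c assume "x \<in> comb ` coords"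
  then obtain a where "a \<in> coords" "x = comb a" by blast
  then show "fun_scale c x \<in> comb ` coords"
    by (intro image_eqI[of _ _ "\<lambda>k. c * a k"])
      (auto simp: comb_cmult coords_cmult fun_eq_iff fun_scale_def)
qed

text \<open>By \<open>coords_le_comb\<close> the coordinates of the approximants are Cauchy in every
  weighted supremum norm. Their limit lies in \<open>coords\<close>, and by
  \<open>comb_le_coords\<close> its combination is the limit of the approximants, which is
  \<open>g\<close>.\<close>

lemma comb_limit:
  assumes g: "\<And>m. A m \<in> coords"
    and close: "\<And>m z. norm z \<le> real m \<Longrightarrow> norm (g z - comb (A m) z) < 1 / Suc m"
  shows "g \<in> comb ` coords"
proof -
  have bound: "\<exists>C>0. \<forall>m n k. r \<le> real m \<longrightarrow> r \<le> real n \<longrightarrow>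
      norm (A m k - A n k) * r ^ p k \<le> C * (1 / Suc m + 1 / Suc n)" if "r \<ge> 1" for r
  proof -
    obtain C where C: "C > 0" "\<And>a M k. a \<in> coords \<Longrightarrow> (\<And>z. norm z \<le> r \<Longrightarrow> norm (comb a z) \<le> M)
        \<Longrightarrow> norm (a k) * r ^ p k \<le> C * M"
      using coords_le_comb[of r] \<open>1 \<le> r\<close> by metis
    have "norm (A m k - A n k) * r ^ p k \<le> C * (1 / Suc m + 1 / Suc n)"
      if "r \<le> real m" "r \<le> real n" for m n k
    proof (rule C(2)[of "\<lambda>k. A m k - A n k"])
      fix z :: complex assume "norm z \<le> r"
      then have "norm (g z - comb (A m) z) < 1 / Suc m" "norm (g z - comb (A n) z) < 1 / Suc n"
        using that by (meson close order_trans)+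
      then show "norm (comb (\<lambda>k. A m k - A n k) z) \<le> 1 / Suc m + 1 / Suc n"
        using norm_triangle_ineq4[of "g z - comb (A n) z" "g z - comb (A m) z"]
        by (simp add: comb_diff g)
    qed (intro coords_diff g)
    with C(1) show ?thesis by blast
  qed
  have inv0: "(\<lambda>n. 1 / real (Suc n)) \<longlonglongrightarrow> 0"
    using LIMSEQ_inverse_real_of_nat by (simp add: inverse_eq_divide)
  have "Cauchy (\<lambda>m. A m k)" for k
  proof (rule CauchyI)
    fix e :: real assume e: "e > 0"
    obtain C where C: "C > 0" "\<And>m n k. 1 \<le> real m \<Longrightarrow> 1 \<le> real n \<Longrightarrow>
        norm (A m k - A n k) * 1 ^ p k \<le> C * (1 / Suc m + 1 / Suc n)"
      using bound[of 1] by auto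
    have "eventually (\<lambda>n. 1 / real (Suc n) < e / (2 * C)) sequentially"
      using e C(1) by (intro order_tendstoD(2)[OF inv0]) auto
    then obtain N where N: "\<And>n. n \<ge> N \<Longrightarrow> 1 / real (Suc n) < e / (2 * C)"
      by (auto simp: eventually_sequentially)
    show "\<exists>N. \<forall>m\<ge>N. \<forall>n\<ge>N. norm (A m k - A n k) < e"
    proof (intro exI[of _ "max N 1"] allI impI)
      fix m n assume mn: "max N 1 \<le> m" "max N 1 \<le> n"
      have "norm (A m k - A n k) \<le> C * (1 / Suc m + 1 / Suc n)"
        using C(2)[of m n k] mn by simp
      also have "\<dots> < C * (e / (2 * C) + e / (2 * C))"
        using N[of m] N[of n] mn C(1) by (intro mult_strict_left_mono add_strict_mono) auto
      also have "\<dots> = e" using C(1) by (simp add: field_simps)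
      finally show "norm (A m k - A n k) < e" .
    qed
  qed
  then have "\<exists>l. (\<lambda>m. A m k) \<longlonglongrightarrow> l" for k
    by (simp add: Cauchy_convergent_iff convergent_def)
  then obtain a where lim: "\<And>k. (\<lambda>m. A m k) \<longlonglongrightarrow> a k" by metis
  \<comment> \<open>The index \<open>n\<close> of \<open>bound\<close> tends to infinity while
    \<open>m\<close> stays fixed.\<close>
  have limit_bound: "\<exists>C>0. \<forall>m k. r \<le> real m \<longrightarrow> norm (A m k - a k) * r ^ p k \<le> C / Suc m" if r: "r \<ge> 1" for r
  proof -
    obtain C where C: "C > 0" "\<And>m n k. r \<le> real m \<Longrightarrow> r \<le> real n \<Longrightarrow>
        norm (A m k - A n k) * r ^ p k \<le> C * (1 / Suc m + 1 / Suc n)"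
      using bound[OF r] by blast
    have "norm (A m k - a k) * r ^ p k \<le> C / Suc m" if m: "r \<le> real m" for m k
    proof -
      have "(\<lambda>n. norm (A m k - A n k) * r ^ p k) \<longlonglongrightarrow> norm (A m k - a k) * r ^ p k"
        by (intro tendsto_intros lim)
      moreover have "(\<lambda>n. C * (1 / Suc m + 1 / Suc n)) \<longlonglongrightarrow> C * (1 / Suc m + 0)"
        by (intro tendsto_intros inv0)
      moreover have "\<exists>N. \<forall>n\<ge>N. norm (A m k - A n k) * r ^ p k \<le> C * (1 / Suc m + 1 / Suc n)"
        using C(2)[OF m] by (metis dual_order.trans nat_ceiling_le_eq)
      ultimately show ?thesis
        using LIMSEQ_le by fastforce
    qed
    with C(1) show ?thesis by blast
  qed
  have a: "a \<in> coords"
    unfolding coords_def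
  proof (intro CollectI allI impI)
    fix r :: real assume r: "r \<ge> 0"
    \<comment> \<open>The factor 2 produces the summable \<open>(1/2) ^ p k\<close>; the added 1
      ensures \<open>R \<ge> 1\<close>, as \<open>limit_bound\<close> requires.\<close>
    define R where "R = 2 * (r + 1)"
    obtain C where C: "C > 0" "\<And>m k. R \<le> real m \<Longrightarrow> norm (A m k - a k) * R ^ p k \<le> C / Suc m"
      using limit_bound[of R] r by (auto simp: R_def)
    obtain m where m: "R \<le> real m" using real_arch_simple by blast
    show "summable (\<lambda>k. norm (a k) * r ^ p k)"
    proof (rule summable_comparison_test')
      show "summable (\<lambda>k. norm (A m k) * r ^ p k + C * (1/2) ^ k)"
        by (intro summable_add coordsD g r summable_mult summable_geometric) auto
      fix k
      have "norm (A m k - a k) * (2 * r) ^ p k \<le> norm (A m k - a k) * R ^ p k"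
        using r by (intro mult_left_mono power_mono) (auto simp: R_def)
      also have "\<dots> \<le> C / Suc m" by (rule C(2)[OF m])
      also have "\<dots> \<le> C" using C(1) by (simp add: field_simps)
      finally have "norm (A m k - a k) * (2 * r) ^ p k \<le> C" .
      then have "norm (A m k - a k) * r ^ p k \<le> C * (1/2) ^ p k"
        by (simp add: field_simps power_divide power_mult_distrib)
      also have "\<dots> \<le> C * (1/2) ^ k"
        using C(1) by (intro mult_left_mono half_power_p) auto
      finally have "norm (A m k - a k) * r ^ p k \<le> C * (1/2) ^ k" .
      moreover have "norm (a k) \<le> norm (A m k) + norm (A m k - a k)"
        using norm_triangle_ineq2[of "a k" "A m k"] by (simp add: norm_minus_commute)
      then have "norm (a k) * r ^ p k \<le> (norm (A m k) + norm (A m k - a k)) * r ^ p k"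
        using r by (intro mult_right_mono) auto
      ultimately show "norm (norm (a k) * r ^ p k) \<le> norm (A m k) * r ^ p k + C * (1/2) ^ k"
        using r by (simp add: distrib_right)
    qed
  qed
  have "g z = comb a z" for z
  proof -
    define r where "r = max 1 (norm z)"
    obtain C where C: "C > 0" "\<And>m k. 2 * r \<le> real m \<Longrightarrow> norm (A m k - a k) * (2 * r) ^ p k \<le> C / Suc m"
    proof -
      have "2 * r \<ge> 1" by (simp add: r_def)
      from limit_bound[OF this] show ?thesis using that by blast
    qed
    obtain C' where C': "C' > 0" "\<And>a e z. a \<in> coords \<Longrightarrow> (\<And>k. norm (a k) * (2 * r) ^ p k \<le> e) \<Longrightarrow>
        norm z \<le> r \<Longrightarrow> norm (comb a z) \<le> C' * e"
      using comb_le_coords[of r] unfolding r_def by (metis max.cobounded1)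
    have "norm (g z - comb a z) \<le> 1 / Suc m + C' * (C * (1 / Suc m))" if m: "2 * r \<le> real m" for m
    proof -
      have "norm (comb (\<lambda>k. A m k - a k) z) \<le> C' * (C / Suc m)"
        using C(2)[OF m] by (intro C'(2) coords_diff g a) (auto simp: r_def)
      moreover have "norm z \<le> real m" using m by (simp add: r_def)
      then have "norm (g z - comb (A m) z) < 1 / Suc m" by (rule close)
      ultimately show ?thesis
        using norm_triangle_ineq[of "g z - comb (A m) z" "comb (A m) z - comb a z"]
        by (simp add: comb_diff g a)
    qed
    then have "\<exists>N. \<forall>m\<ge>N. norm (g z - comb a z) \<le> 1 / Suc m + C' * (C * (1 / Suc m))"
      by (metis dual_order.trans nat_ceiling_le_eq)
    moreover have "(\<lambda>m. 1 / Suc m + C' * (C * (1 / Suc m))) \<longlonglongrightarrow> 0 + C' * (C * 0)"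
      by (intro tendsto_intros inv0)
    ultimately have "norm (g z - comb a z) \<le> 0"
      using LIMSEQ_le_const by fastforce
    then show ?thesis by simp
  qed
  then show ?thesis using a by blast
qed

text \<open>If no basic neighbourhood of \<open>g\<close> avoided the subspace, the discs of radius
  \<open>m\<close> with tolerance \<open>1 / Suc m\<close> would supply a sequence of combinations
  to which \<open>comb_limit\<close> applies.\<close>

lemma closedin_comb: "closedin entire_space (comb ` coords)"
  unfolding closedin_def
proof
  show "comb ` coords \<subseteq> topspace entire_space"
    by (auto simp: topspace_entire_space comb_holomorphic)
  show "openin entire_space (topspace entire_space - comb ` coords)"
    unfolding openin_entire_space open_in_entire_def
  proof (intro conjI ballI)
    fix g assume g: "g \<in> topspace entire_space - comb ` coords"
    show "\<exists>K e. compact K \<and> e > 0 \<and> compact_nbhd g K e \<subseteq> topspace entire_space - comb ` coords"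
    proof (rule ccontr)
      assume *: "\<not> ?thesis"
      have "\<exists>a\<in>coords. comb a \<in> compact_nbhd g (cball 0 (real m)) (1 / Suc m)" for m
      proof -
        have "\<not> compact_nbhd g (cball 0 (real m)) (1 / Suc m) \<subseteq> topspace entire_space - comb ` coords"
          using * by (meson compact_cball divide_pos_pos of_nat_0_less_iff zero_less_Suc zero_less_one)
        then show ?thesis by (auto simp: topspace_entire_space compact_nbhd_def)
      qed
      then obtain A where A: "\<And>m. A m \<in> coords"
        "\<And>m. comb (A m) \<in> compact_nbhd g (cball 0 (real m)) (1 / Suc m)" by metis
      have "norm (g z - comb (A m) z) < 1 / Suc m" if "norm z \<le> real m" for m z
        using A(2)[of m] that by (auto simp: compact_nbhd_def dist_norm)
      with A(1) have "g \<in> comb ` coords" by (rule comb_limit)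
      with g show False by simp
    qed
  qed (auto simp: topspace_entire_space)
qed

text \<open>The combinations with coordinates \<open>t ^ k / (k + 1) ^ p k\<close>, \<open>0 < t < 1\<close>, are independent by
  a Vandermonde argument.\<close>
lemma has_algebraic_dim_comb: "has_algebraic_dim fun_scale (comb ` coords) |UNIV :: real set|"
proof (rule has_algebraic_dim_continuum[OF subspace_comb])
  define v :: "real \<Rightarrow> nat \<Rightarrow> complex" where
    "v t = (\<lambda>k. of_real (t ^ k) / of_nat (Suc k) ^ p k)" for t
  have v: "v t \<in> coords" if t: "t \<in> {0<..<1}" for t
    unfolding coords_def
  proof (intro CollectI allI impI)
    fix r :: real assume r: "r \<ge> 0"
    obtain N :: nat where N: "2 * r \<le> real N" using real_arch_simple by blast
    show "summable (\<lambda>k. norm (v t k) * r ^ p k)"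
    proof (rule summable_comparison_test'[where N = N])
      show "summable (\<lambda>k. (1/2::real) ^ k)" by (intro summable_geometric) auto
      fix k assume k: "N \<le> k"
      have "norm (v t k) * r ^ p k = t ^ k * (r / real (Suc k)) ^ p k"
        using t by (simp add: v_def norm_divide norm_power power_divide del: of_nat_Suc)
      also have "\<dots> \<le> 1 * (1/2) ^ p k"
        using t r N k by (intro mult_mono power_mono power_le_one) (auto simp: field_simps)
      also have "\<dots> \<le> (1/2) ^ k" using half_power_p by simp
      finally show "norm (norm (v t k) * r ^ p k) \<le> (1/2) ^ k" using r by simp
    qed
  qed
  have vanish: "u s = 0"
    if T: "finite T" "T \<subseteq> {0<..<1}" and sum: "\<And>z. (\<Sum>t\<in>T. u t * comb (v t) z) = 0" and s: "s \<in> T"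
    for T and u :: "real \<Rightarrow> complex" and s
  proof -
    have comb_sum: "(\<lambda>k. \<Sum>t\<in>T. u t * v t k) \<in> coords \<and>
        comb (\<lambda>k. \<Sum>t\<in>T. u t * v t k) = (\<lambda>z. \<Sum>t\<in>T. u t * comb (v t) z)"
      using T
    proof (induction T rule: finite_induct)
      case empty
      then show ?case by (simp add: coords_0 comb_0)
    next
      case (insert t T)
      then show ?case
        using v[of t] coords_add[OF coords_cmult[of "v t" "u t"]]
          comb_add[OF coords_cmult[of "v t" "u t"]] comb_cmult[of "v t" "u t"]
        by (auto simp: fun_eq_iff)
    qed
    then have "(\<lambda>k. \<Sum>t\<in>T. u t * v t k) = (\<lambda>k. 0)"
      using sum by (subst comb_eq_0_iff[symmetric]) auto
    then have "(\<Sum>t\<in>T. u t * v t k) = 0" for k by (rule fun_cong)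
    moreover have "(\<Sum>t\<in>T. u t * v t k) = (\<Sum>t\<in>T. u t * of_real t ^ k) / of_nat (Suc k) ^ p k" for k
      by (simp add: v_def sum_divide_distrib del: of_nat_Suc)
    ultimately have mono: "(\<Sum>t\<in>T. u t * of_real t ^ k) = 0" for k
      by (simp del: of_nat_Suc)
    have poly: "(\<Sum>t\<in>T. u t * poly q (of_real t)) = 0" for q
    proof -
      have "(\<Sum>t\<in>T. u t * poly q (of_real t)) =
          (\<Sum>t\<in>T. \<Sum>k\<le>degree q. coeff q k * (u t * of_real t ^ k))"
        by (simp add: poly_altdef sum_distrib_left algebra_simps)
      also have "\<dots> = (\<Sum>k\<le>degree q. coeff q k * (\<Sum>t\<in>T. u t * of_real t ^ k))"
        by (subst sum.swap) (simp add: sum_distrib_left)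
      finally show ?thesis by (simp add: mono)
    qed
    \<comment> \<open>This polynomial vanishes at every point of \<open>T\<close> except
      \<open>s\<close>, so it isolates the coefficient \<open>u s\<close>.\<close>
    define q :: "complex poly" where "q = (\<Prod>t\<in>T - {s}. [:- of_real t, 1:])"
    have q0: "poly q (of_real t) = 0" if "t \<in> T - {s}" for t
      using that T(1) by (auto simp: q_def poly_prod)
    have "(\<Sum>t\<in>T. u t * poly q (of_real t)) = (\<Sum>t\<in>{s}. u t * poly q (of_real t))"
      using T(1) s q0 by (intro sum.mono_neutral_right) auto
    then have "u s * poly q (of_real s) = 0" using poly by simp
    moreover have "poly q (of_real s) \<noteq> 0"
      using T(1) by (auto simp: q_def poly_prod)
    ultimately show ?thesis by simp
  qed
  have inj: "inj_on (\<lambda>t. comb (v t)) {0<..<1}"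
  proof (rule inj_onI, rule ccontr)
    fix s t :: real assume st: "s \<in> {0<..<1}" "t \<in> {0<..<1}" "comb (v s) = comb (v t)" "s \<noteq> t"
    have "(if s = s then 1 else (-1::complex)) = 0"
      by (rule vanish[of "{s, t}" "\<lambda>x. if x = s then 1 else -1"]) (use st in auto)
    then show False by simp
  qed
  let ?S = "(\<lambda>t. comb (v t)) ` {0<..<1}"
  show "?S \<subseteq> comb ` coords" using v by blast
  show "comb ` coords \<subseteq> {f. f holomorphic_on UNIV}" by (auto simp: comb_holomorphic)
  show "(UNIV :: real set) \<lesssim> ?S"
    using inj open_interval_eqpoll_reals[of 0 1]
    by (metis eqpoll_imp_lepoll eqpoll_sym inj_on_image_eqpoll_self lepoll_trans zero_less_one)
  show "entire_vs.independent ?S"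
    unfolding entire_vs.independent_explicit_module
  proof (intro allI impI)
    fix X u x assume X: "finite X" "X \<subseteq> ?S" "(\<Sum>x\<in>X. fun_scale (u x) x) = 0" "x \<in> X"
    obtain T where T: "T \<subseteq> {0<..<1}" "finite T" "X = (\<lambda>t. comb (v t)) ` T"
      using X(1,2) by (metis finite_subset_image)
    then obtain s where s: "s \<in> T" "x = comb (v s)" using X(4) by blast
    have "(\<Sum>t\<in>T. fun_scale (u (comb (v t))) (comb (v t))) = 0"
      using X(3) sum.reindex[OF inj_on_subset[OF inj T(1)], of "\<lambda>x. fun_scale (u x) x"]
      by (simp add: T(3))
    moreover have "(\<Sum>t\<in>A. fun_scale (c t) (g t)) z = (\<Sum>t\<in>A. c t * g t z)" for A c g and z :: complex
      by (induction A rule: infinite_finite_induct) (auto simp: fun_scale_def)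
    ultimately have "(\<Sum>t\<in>T. u (comb (v t)) * comb (v t) z) = 0" for z
      by (metis zero_fun_apply)
    then show "u x = 0"
      using vanish[OF T(2,1) _ s(1), of "\<lambda>t. u (comb (v t))"] s(2) by blast
  qed
qed

end

subsection \<open>Hypercyclic vectors\<close>

text \<open>The distance between \<open>f\<close> and a member \<open>g\<close> attains its maximum
  on \<open>K\<close>, strictly below \<open>e\<close>. The remaining slack is a radius that works
  around \<open>g\<close>; empty \<open>K\<close> has no maximum and is treated apart.\<close>

lemma open_compact_nbhd:
  assumes f: "f holomorphic_on UNIV" and K: "compact K"
  shows "open_in_entire (compact_nbhd f K e)"
  unfolding open_in_entire_def
proof (intro conjI ballI)
  fix g assume g: "g \<in> compact_nbhd f K e"
  show "\<exists>L d. compact L \<and> d > 0 \<and> compact_nbhd g L d \<subseteq> compact_nbhd f K e"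
  proof (cases "K = {}")
    case True
    have "compact_nbhd g {} 1 \<subseteq> compact_nbhd f K e"
      using True by (auto simp: compact_nbhd_def)
    then show ?thesis by (intro exI[of _ "{}"] exI[of _ 1]) auto
  next
    case False
    have "continuous_on K (\<lambda>z. dist (f z) (g z))"
      using f g by (intro continuous_intros holomorphic_on_imp_continuous_on)
        (auto simp: compact_nbhd_def intro: holomorphic_on_subset)
    then obtain w where w: "w \<in> K" "\<And>z. z \<in> K \<Longrightarrow> dist (f z) (g z) \<le> dist (f w) (g w)"
      using continuous_attains_sup[OF K False] by blast
    define d where "d = e - dist (f w) (g w)"
    have "compact_nbhd g K d \<subseteq> compact_nbhd f K e"
    proof
      fix h assume h: "h \<in> compact_nbhd g K d"
      have "dist (f z) (h z) < e" if "z \<in> K" for z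
      proof -
        have "dist (g z) (h z) < d" using h that by (simp add: compact_nbhd_def)
        then show ?thesis
          using w(2)[OF that] dist_triangle[of "f z" "h z" "g z"] by (simp add: d_def)
      qed
      with h show "h \<in> compact_nbhd f K e" by (simp add: compact_nbhd_def)
    qed
    moreover have "d > 0" using g w(1) by (simp add: d_def compact_nbhd_def)
    ultimately show ?thesis using K by blast
  qed
qed (auto simp: compact_nbhd_def)

abbreviation (input) hypercyclic_entire :: "(nat \<Rightarrow> complex poly) \<Rightarrow> (complex \<Rightarrow> complex) set" where
  "hypercyclic_entire P \<equiv> hypercyclic_vectors entire_space entire_space (\<lambda>n. diff_op (P n))"

lemma hypercyclic_holomorphic:
  "x \<in> hypercyclic_entire P \<Longrightarrow> x holomorphic_on UNIV"
  by (simp add: hypercyclic_vectors_def topspace_entire_space)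

lemma hypercyclic_approx:
  assumes x: "x \<in> hypercyclic_entire P" and g: "g holomorphic_on UNIV" and e: "e > 0"
  obtains n where "n \<ge> 1" "\<And>z. norm z \<le> r \<Longrightarrow> norm (diff_op (P n) x z - g z) < e"
proof -
  have "g \<in> entire_space closure_of {diff_op (P n) x | n. n \<ge> 1}"
    using x g by (simp add: hypercyclic_vectors_def topspace_entire_space)
  moreover have "openin entire_space (compact_nbhd g (cball 0 r) e)"
    using g by (simp add: openin_entire_space open_compact_nbhd)
  moreover have "g \<in> compact_nbhd g (cball 0 r) e"
    using g e by (simp add: compact_nbhd_def)
  ultimately obtain n where "n \<ge> 1" "diff_op (P n) x \<in> compact_nbhd g (cball 0 r) e"
    unfolding in_closure_of by blast
  then show ?thesis
    by (intro that[of n]) (auto simp: compact_nbhd_def dist_norm norm_minus_commute)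
qed

text \<open>The orbit of \<open>x\<close> is dense already, so its points are enough as targets.
  This leaves a countable list, of which a recursive construction can serve an initial segment at
  each stage.\<close>

lemma hypercyclic_if_orbit_approx:
  assumes x: "x \<in> hypercyclic_entire P" and f: "f holomorphic_on UNIV"
    and approx: "\<And>t r e. t \<ge> 1 \<Longrightarrow> r \<ge> 0 \<Longrightarrow> e > 0 \<Longrightarrow>
      \<exists>n\<ge>1. \<forall>z. norm z \<le> r \<longrightarrow> norm (diff_op (P n) f z - diff_op (P t) x z) < e"
  shows "f \<in> hypercyclic_entire P"
proof -
  have "g \<in> entire_space closure_of {diff_op (P n) f | n. n \<ge> 1}" if g: "g holomorphic_on UNIV" for g
    unfolding in_closure_of
  proof (intro conjI allI impI)
    fix V assume "g \<in> V \<and> openin entire_space V"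
    then obtain K e where K: "compact K" "e > 0" "compact_nbhd g K e \<subseteq> V"
      unfolding openin_entire_space open_in_entire_def by blast
    obtain r where r: "r > 0" "\<And>z. z \<in> K \<Longrightarrow> norm z \<le> r"
      using compact_imp_bounded[OF K(1)] unfolding bounded_pos by blast
    obtain t where t: "t \<ge> 1" "\<And>z. norm z \<le> r \<Longrightarrow> norm (diff_op (P t) x z - g z) < e / 2"
      using hypercyclic_approx[OF x g, of "e / 2" r] K(2) by auto
    obtain n where n: "n \<ge> 1"
      "\<And>z. norm z \<le> r \<Longrightarrow> norm (diff_op (P n) f z - diff_op (P t) x z) < e / 2"
      using approx[OF t(1), of r "e / 2"] r(1) K(2) by auto
    have "norm (g z - diff_op (P n) f z) < e" if "z \<in> K" for z
      using t(2)[OF r(2)[OF that]] n(2)[OF r(2)[OF that]]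
        norm_triangle_ineq[of "diff_op (P n) f z - diff_op (P t) x z" "diff_op (P t) x z - g z"]
      by (simp add: norm_minus_commute)
    then have "diff_op (P n) f \<in> compact_nbhd g K e"
      using f by (simp add: compact_nbhd_def dist_norm diff_op_holomorphic)
    with K(3) n(1) show "\<exists>y. y \<in> {diff_op (P n) f | n. n \<ge> 1} \<and> y \<in> V" by blast
  qed (use g in \<open>simp add: topspace_entire_space\<close>)
  then have "entire_space closure_of {diff_op (P n) f | n. n \<ge> 1} = topspace entire_space"
    by (intro subset_antisym closure_of_subset_topspace) (auto simp: topspace_entire_space)
  with f show ?thesis
    by (simp add: hypercyclic_vectors_def topspace_entire_space)
qed

text \<open>Otherwise \<open>x\<close> would be zero, and so would its whole orbit, which then stays
  away from the constant 1.\<close>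

lemma hypercyclic_taylor_coeff_nonzero:
  assumes x: "x \<in> hypercyclic_entire P"
  obtains q where "taylor_coeff q x \<noteq> 0"
proof -
  have "\<not> (\<forall>q. taylor_coeff q x = 0)"
  proof
    assume "\<forall>q. taylor_coeff q x = 0"
    then have "x = (\<lambda>z. 0)"
      using hypercyclic_holomorphic[OF x] entire_eq_0_if_taylor_coeff_0 by blast
    then have 0: "diff_op (P n) x z = 0" for n z
      by (simp add: diff_op_def)
    obtain n where "norm (diff_op (P n) x 0 - 1) < 1"
      using hypercyclic_approx[OF x, of "\<lambda>z. 1" 1 0] by auto
    with 0 show False by simp
  qed
  with that show ?thesis by blast
qed

section \<open>Finitely many times for a compact set of coefficients\<close>

text \<open>For the largest index \<open>m \<le> i\<close> with \<open>a m \<noteq> 0\<close>, the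
  coefficient at \<open>degree (\<phi> m)\<close> receives a contribution from
  \<open>\<phi> m\<close> alone.\<close>

lemma sum_smult_nonzero:
  fixes \<phi> :: "nat \<Rightarrow> complex poly"
  assumes deg: "\<And>j k. j < k \<Longrightarrow> k \<le> i \<Longrightarrow> degree (\<phi> j) < degree (\<phi> k)" and \<phi>0: "\<phi> 0 \<noteq> 0"
    and k: "k \<le> i" "a k \<noteq> 0"
  shows "(\<Sum>k\<le>i. smult (a k) (\<phi> k)) \<noteq> 0"
proof -
  define m where "m = Max {k. k \<le> i \<and> a k \<noteq> 0}"
  have m: "m \<in> {k. k \<le> i \<and> a k \<noteq> 0}"
    unfolding m_def using k by (intro Max_in) auto
  have gt: "a l = 0" if "l \<le> i" "m < l" for l
  proof (rule ccontr)
    assume "a l \<noteq> 0"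
    then have "l \<le> m" unfolding m_def using that by (intro Max_ge) auto
    with that show False by simp
  qed
  have "\<phi> m \<noteq> 0" using \<phi>0 deg[of 0 m] m by (cases "m = 0") auto
  have "coeff (\<Sum>k\<le>i. smult (a k) (\<phi> k)) (degree (\<phi> m)) = (\<Sum>k\<le>i. a k * coeff (\<phi> k) (degree (\<phi> m)))"
    by (simp add: coeff_sum)
  also have "\<dots> = (\<Sum>k\<in>{m}. a k * coeff (\<phi> k) (degree (\<phi> m)))"
  proof (intro sum.mono_neutral_right ballI)
    fix l assume l: "l \<in> {..i} - {m}"
    then consider "l < m" | "m < l" by fastforce
    then show "a l * coeff (\<phi> l) (degree (\<phi> m)) = 0"
      using l m gt[of l] deg[of l m] by cases (auto intro: coeff_eq_0)
  qed (use m in auto)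
  also have "\<dots> \<noteq> 0" using m \<open>\<phi> m \<noteq> 0\<close> by simp
  finally show ?thesis by auto
qed

text \<open>Tychonoff's theorem gives compactness of the product of discs. The lower bound involves
  finitely many coordinates, so it is a closed condition in the product topology.\<close>

lemma compact_coord_box:
  "compact {a :: nat \<Rightarrow> complex. (\<forall>k. norm (a k) \<le> M) \<and> c \<le> (\<Sum>k\<le>i. norm (a k))}"
proof -
  have "compactin (product_topology (\<lambda>_. euclidean) UNIV) (Pi\<^sub>E UNIV (\<lambda>_::nat. cball (0::complex) M))"
    by (simp add: compactin_PiE)
  then have "compact (Pi\<^sub>E UNIV (\<lambda>_::nat. cball (0::complex) M))"
    by (simp add: euclidean_product_topology)
  moreover have "closed {a :: nat \<Rightarrow> complex. c \<le> (\<Sum>k\<le>i. norm (a k))}"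
    by (intro closed_Collect_le continuous_intros) (auto intro: continuous_on_product_coordinates)
  ultimately have "compact (Pi\<^sub>E UNIV (\<lambda>_. cball 0 M) \<inter> {a :: nat \<Rightarrow> complex. c \<le> (\<Sum>k\<le>i. norm (a k))})"
    by (rule compact_Int_closed)
  also have "Pi\<^sub>E UNIV (\<lambda>_. cball 0 M) \<inter> {a :: nat \<Rightarrow> complex. c \<le> (\<Sum>k\<le>i. norm (a k))} =
      {a. (\<forall>k. norm (a k) \<le> M) \<and> c \<le> (\<Sum>k\<le>i. norm (a k))}"
    by (auto simp: PiE_def Pi_def extensional_def)
  finally show ?thesis .
qed

text \<open>For fixed \<open>a\<close>, the polynomial
  \<open>\<psi> = (\<Sum>k\<le>i. smult (a k) (\<phi> k))\<close> is nonzero, so \<open>g\<close> is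
  \<open>\<psi>(D) h\<close> for some entire \<open>h\<close>; a time \<open>n\<close> at which the
  orbit is near \<open>h\<close> then serves \<open>g\<close>. The same \<open>n\<close> works for
  all nearby coefficients, and compactness leaves finitely many times.\<close>

lemma finite_universal_times_single:
  fixes \<phi> :: "nat \<Rightarrow> complex poly"
  assumes x: "x \<in> hypercyclic_entire P"
    and deg: "\<And>j k. j < k \<Longrightarrow> k \<le> i \<Longrightarrow> degree (\<phi> j) < degree (\<phi> k)" and \<phi>0: "\<phi> 0 \<noteq> 0"
    and g: "g holomorphic_on UNIV" and e: "e > 0" and c: "c > 0"
  shows "\<exists>N. finite N \<and> (\<forall>n\<in>N. n \<ge> 1) \<and>
    (\<forall>a. (\<forall>k. norm (a k) \<le> M) \<and> c \<le> (\<Sum>k\<le>i. norm (a k)) \<longrightarrow>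
      (\<exists>n\<in>N. \<forall>z. norm z \<le> r \<longrightarrow>
        norm ((\<Sum>k\<le>i. a k * diff_op (\<phi> k) (diff_op (P n) x) z) - g z) \<le> e))"
proof -
  define K where "K = {a :: nat \<Rightarrow> complex. (\<forall>k. norm (a k) \<le> M) \<and> c \<le> (\<Sum>k\<le>i. norm (a k))}"
  have hx: "x holomorphic_on UNIV" using x by (rule hypercyclic_holomorphic)
  have "\<exists>n\<ge>1. \<forall>z. norm z \<le> r \<longrightarrow>
      norm ((\<Sum>k\<le>i. a k * diff_op (\<phi> k) (diff_op (P n) x) z) - g z) \<le> e / 2" if a: "a \<in> K" for a
  proof -
    define \<psi> where "\<psi> = (\<Sum>k\<le>i. smult (a k) (\<phi> k))"
    have "\<exists>k\<le>i. a k \<noteq> 0"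
    proof (rule ccontr)
      assume "\<not> ?thesis"
      then have "(\<Sum>k\<le>i. norm (a k)) = 0" by simp
      with a c show False by (simp add: K_def)
    qed
    then have "\<psi> \<noteq> 0"
      unfolding \<psi>_def using sum_smult_nonzero[where \<phi> = \<phi> and i = i, OF deg \<phi>0] by blast
    then obtain h where h: "h holomorphic_on UNIV" "diff_op \<psi> h = g"
      using diff_op_surj[OF _ g] by blast
    \<comment> \<open>Applying \<open>\<psi>(D)\<close> costs the factor
      \<open>op_size \<psi>\<close> and 1 in the radius, hence this tolerance and the disc of radius
      \<open>r + 1\<close> below. The added 1 keeps the denominator positive.\<close>
    define d where "d = e / 2 / (op_size \<psi> + 1)"
    have d: "d > 0" using e op_size_nonneg[of \<psi>] by (simp add: d_def)
    obtain n where n: "n \<ge> 1" "\<And>z. norm z \<le> r + 1 \<Longrightarrow> norm (diff_op (P n) x z - h z) < d"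
      using hypercyclic_approx[OF x h(1) d, of "r + 1"] by blast
    have "norm ((\<Sum>k\<le>i. a k * diff_op (\<phi> k) (diff_op (P n) x) z) - g z) \<le> e / 2" if z: "norm z \<le> r" for z
    proof -
      have "(\<Sum>k\<le>i. a k * diff_op (\<phi> k) (diff_op (P n) x) z) = diff_op \<psi> (diff_op (P n) x) z"
        by (simp add: \<psi>_def diff_op_sum_left diff_op_smult_left)
      then have "(\<Sum>k\<le>i. a k * diff_op (\<phi> k) (diff_op (P n) x) z) - g z =
          diff_op \<psi> (\<lambda>z. diff_op (P n) x z - h z) z"
        by (simp add: diff_op_diff_right diff_op_holomorphic hx h)
      also have "norm \<dots> \<le> op_size \<psi> * d"
        using n(2) by (intro norm_diff_op_le_cball[OF _ z] holomorphic_intros hx h(1)) (auto intro: less_imp_le)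
      also have "\<dots> \<le> e / 2"
        using e op_size_nonneg[of \<psi>] by (simp add: d_def field_simps)
      finally show ?thesis .
    qed
    with n(1) show ?thesis by blast
  qed
  then obtain n where n: "\<And>a. a \<in> K \<Longrightarrow> n a \<ge> 1"
    "\<And>a z. a \<in> K \<Longrightarrow> norm z \<le> r \<Longrightarrow>
      norm ((\<Sum>k\<le>i. a k * diff_op (\<phi> k) (diff_op (P (n a)) x) z) - g z) \<le> e / 2"
    by metis
  have "\<exists>B\<ge>0. \<forall>z. norm z \<le> r \<longrightarrow> norm (diff_op (\<phi> k) (diff_op (P (n a)) x) z) \<le> B" for a k
    by (intro entire_bounded holomorphic_intros hx)
  then have "\<exists>B. \<forall>a k. B a k \<ge> 0 \<and>
      (\<forall>z. norm z \<le> r \<longrightarrow> norm (diff_op (\<phi> k) (diff_op (P (n a)) x) z) \<le> B a k)"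
    by (intro choice allI) blast
  then obtain B where B: "\<And>a k. B a k \<ge> 0"
    "\<And>a k z. norm z \<le> r \<Longrightarrow> norm (diff_op (\<phi> k) (diff_op (P (n a)) x) z) \<le> B a k"
    by blast
  \<comment> \<open>For \<open>b\<close> in this neighbourhood, replacing \<open>a\<close> by
    \<open>b\<close> at the same time \<open>n a\<close> moves the sum by less than
    \<open>e / 2\<close>.\<close>
  define U where "U a = {b :: nat \<Rightarrow> complex. (\<Sum>k\<le>i. norm (b k - a k) * B a k) < e / 2}" for a
  have "open (U a)" for a
    unfolding U_def
    by (intro open_Collect_less continuous_intros) (auto intro: continuous_on_product_coordinates)
  moreover have "K \<subseteq> (\<Union>a\<in>K. U a)" using e by (auto simp: U_def)
  ultimately obtain A where A: "A \<subseteq> K" "finite A" "K \<subseteq> (\<Union>a\<in>A. U a)"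
    using compactE_image[OF compact_coord_box[of M c i, folded K_def], of K U] by blast
  have "\<exists>m\<in>n ` A. \<forall>z. norm z \<le> r \<longrightarrow>
      norm ((\<Sum>k\<le>i. b k * diff_op (\<phi> k) (diff_op (P m) x) z) - g z) \<le> e" if b: "b \<in> K" for b
  proof -
    obtain a where a: "a \<in> A" "b \<in> U a" using A(3) b by blast
    have "norm ((\<Sum>k\<le>i. b k * diff_op (\<phi> k) (diff_op (P (n a)) x) z) - g z) \<le> e"
      if z: "norm z \<le> r" for z
    proof -
      let ?s = "\<lambda>b. \<Sum>k\<le>i. b k * diff_op (\<phi> k) (diff_op (P (n a)) x) z"
      have "?s b - ?s a = (\<Sum>k\<le>i. (b k - a k) * diff_op (\<phi> k) (diff_op (P (n a)) x) z)"
        by (simp add: sum_subtractf left_diff_distrib)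
      also have "norm \<dots> \<le> (\<Sum>k\<le>i. norm (b k - a k) * B a k)"
        by (rule sum_norm_le) (simp add: norm_mult mult_left_mono B(2)[OF z])
      also have "\<dots> < e / 2" using a(2) by (simp add: U_def)
      finally show ?thesis
        using n(2)[of a z] z a(1) A(1) norm_triangle_ineq[of "?s b - ?s a" "?s a - g z"] by auto
    qed
    with a(1) show ?thesis by blast
  qed
  then show ?thesis
    using A(1,2) n(1) by (intro exI[of _ "n ` A"]) (auto simp: K_def)
qed

lemma finite_universal_times:
  fixes \<phi> :: "nat \<Rightarrow> complex poly"
  assumes x: "x \<in> hypercyclic_entire P"
    and deg: "\<And>j k. j < k \<Longrightarrow> k \<le> i \<Longrightarrow> degree (\<phi> j) < degree (\<phi> k)" and \<phi>0: "\<phi> 0 \<noteq> 0"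
    and G: "finite G" "\<And>g. g \<in> G \<Longrightarrow> g holomorphic_on UNIV" and e: "e > 0" and c: "c > 0"
  shows "\<exists>N. finite N \<and> (\<forall>n\<in>N. n \<ge> 1) \<and>
    (\<forall>a. \<forall>g\<in>G. (\<forall>k. norm (a k) \<le> M) \<and> c \<le> (\<Sum>k\<le>i. norm (a k)) \<longrightarrow>
      (\<exists>n\<in>N. \<forall>z. norm z \<le> r \<longrightarrow>
        norm ((\<Sum>k\<le>i. a k * diff_op (\<phi> k) (diff_op (P n) x) z) - g z) \<le> e))"
proof -
  define good where "good g N \<longleftrightarrow> finite N \<and> (\<forall>n\<in>N. n \<ge> 1) \<and>
    (\<forall>a :: nat \<Rightarrow> complex. (\<forall>k. norm (a k) \<le> M) \<and> c \<le> (\<Sum>k\<le>i. norm (a k)) \<longrightarrow>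
      (\<exists>n\<in>N. \<forall>z. norm z \<le> r \<longrightarrow>
        norm ((\<Sum>k\<le>i. a k * diff_op (\<phi> k) (diff_op (P n) x) z) - g z) \<le> e))" for g N
  have "\<exists>N. good g N" if "g \<in> G" for g
    unfolding good_def
    by (rule finite_universal_times_single[where \<phi> = \<phi> and i = i, OF x deg \<phi>0 G(2)[OF that] e c])
  then obtain N where N: "\<And>g. g \<in> G \<Longrightarrow> good g (N g)" by metis
  show ?thesis
  proof (intro exI[of _ "\<Union>g\<in>G. N g"] conjI allI ballI impI)
    show "finite (\<Union>g\<in>G. N g)" using N G(1) by (auto simp: good_def)
    show "n \<ge> 1" if "n \<in> (\<Union>g\<in>G. N g)" for n using N that by (auto simp: good_def)
    fix a :: "nat \<Rightarrow> complex" and g assume g: "g \<in> G" and "(\<forall>k. norm (a k) \<le> M) \<and> c \<le> (\<Sum>k\<le>i. norm (a k))"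
    with N[OF g] obtain n where "n \<in> N g" "\<forall>z. norm z \<le> r \<longrightarrow>
        norm ((\<Sum>k\<le>i. a k * diff_op (\<phi> k) (diff_op (P n) x) z) - g z) \<le> e"
      unfolding good_def by meson
    with g show "\<exists>n\<in>\<Union>g\<in>G. N g. \<forall>z. norm z \<le> r \<longrightarrow>
        norm ((\<Sum>k\<le>i. a k * diff_op (\<phi> k) (diff_op (P n) x) z) - g z) \<le> e"
      by blast
  qed
qed

section \<open>Recursive choice of the perturbed monomials\<close>

text \<open>The exponent \<open>q\<close> is fixed first, so large that \<open>2 ^ q\<close>
  outweighs the operators with index in \<open>N\<close>. Only then does density of the orbit
  provide a polynomial in \<open>D\<close> taking \<open>x\<close> close to
  \<open>z ^ q\<close>.\<close>

lemma exists_near_monomial: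
  fixes i :: nat
  assumes x: "x \<in> hypercyclic_entire P" and N: "finite N" and h: "h holomorphic_on UNIV"
  shows "\<exists>q \<psi>. q0 < q \<and> d < degree \<psi> \<and> norm (taylor_coeff q h) \<le> 1 / 4 \<and>
    (\<forall>z. norm z \<le> real i \<longrightarrow> norm (diff_op \<psi> x z - z ^ q) \<le> (1/2) ^ (i + 2)) \<and>
    (\<forall>n\<in>N. \<forall>z. norm z \<le> real i \<longrightarrow> norm (diff_op (P n) (diff_op \<psi> x) z) \<le> (2 * norm z + 2) ^ q)"
proof -
  have hx: "x holomorphic_on UNIV" using x by (rule hypercyclic_holomorphic)
  obtain M where M: "M \<ge> 0" "\<And>z. norm z \<le> 2 \<Longrightarrow> norm (h z) \<le> M"
    using entire_bounded[OF h, of 2] by blast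
  define s where "s = (\<Sum>n\<in>N. op_size (P n))"
  have s: "s \<ge> 0" unfolding s_def by (intro sum_nonneg op_size_nonneg)
  have op_le: "op_size (P n) \<le> s" if "n \<in> N" for n
    unfolding s_def using N that by (intro member_le_sum op_size_nonneg) auto
  \<comment> \<open>The term \<open>4 * M\<close> serves Cauchy's estimate for \<open>h\<close> on
    the circle of radius 2, and \<open>2 * s\<close> serves the growth bound for the operators
    \<open>P n\<close>.\<close>
  obtain q1 where q1: "4 * M + 2 * s < 2 ^ q1"
    using real_arch_pow[of 2 "4 * M + 2 * s"] by auto
  define q where "q = q1 + q0 + 1"
  have "(2::real) ^ q1 \<le> 2 ^ q" by (intro power_increasing) (auto simp: q_def)
  then have q2: "4 * M \<le> 2 ^ q" "2 * s \<le> 2 ^ q" using q1 M(1) s by linarith+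
  have tc: "norm (taylor_coeff q h) \<le> 1 / 4"
  proof -
    have "norm (taylor_coeff q h) \<le> M / 2 ^ q" using M h by (intro norm_taylor_coeff_le) auto
    also have "\<dots> \<le> 1 / 4" using q2(1) by (simp add: divide_le_eq)
    finally show ?thesis .
  qed
  \<comment> \<open>The first entry is the required closeness to the monomial; the second makes
    \<open>op_size (P n) * e\<close> at most \<open>1/2\<close>. Closeness is needed on radius
    \<open>real i + 1\<close>, since \<open>P n\<close> costs 1 in the radius.\<close>
  define e where "e = min ((1/2) ^ (i + 2)) (1 / (2 * (s + 1)))"
  have e: "e > 0" using s by (simp add: e_def)
  have hq: "(\<lambda>z::complex. z ^ q) holomorphic_on UNIV" by (intro holomorphic_intros)
  obtain m where m: "\<And>z. norm z \<le> real i + 1 \<Longrightarrow> norm (diff_op (P m) x z - z ^ q) < e / 2"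
    using hypercyclic_approx[OF x hq half_gt_zero[OF e], of "real i + 1"] by blast
  \<comment> \<open>A small multiple of \<open>D ^ l\<close> is added to \<open>P m\<close> so that the degrees can be made to increase
    strictly, which keeps the chosen polynomials linearly independent.\<close>
  define l where "l = max d (degree (P m)) + 1"
  have "(deriv ^^ l) x holomorphic_on UNIV" using hx by (intro holomorphic_intros) auto
  then obtain X where X: "X \<ge> 0" "\<And>z. norm z \<le> real i + 1 \<Longrightarrow> norm ((deriv ^^ l) x z) \<le> X"
    using entire_bounded by metis
  define c where "c = e / (2 * (X + 1))"
  have c: "c > 0" "c * X \<le> e / 2" using e X(1) by (auto simp: c_def field_simps)
  define \<psi> where "\<psi> = P m + monom (of_real c) l"
  have "degree \<psi> = l"
    unfolding \<psi>_def using c(1) by (subst degree_add_eq_right) (auto simp: l_def degree_monom_eq)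
  then have deg: "d < degree \<psi>" by (simp add: l_def)
  have near: "norm (diff_op \<psi> x z - z ^ q) \<le> e" if z: "norm z \<le> real i + 1" for z
  proof -
    have "diff_op \<psi> x z - z ^ q = (diff_op (P m) x z - z ^ q) + of_real c * (deriv ^^ l) x z"
      by (simp add: \<psi>_def diff_op_add_left diff_op_monom)
    also have "norm \<dots> \<le> e / 2 + c * X"
      using m[OF z] X(2)[OF z] c(1)
      by (intro norm_triangle_le add_mono) (auto simp: norm_mult)
    also have "\<dots> \<le> e" using c(2) by simp
    finally show ?thesis .
  qed
  have "norm (diff_op (P n) (diff_op \<psi> x) z) \<le> (2 * norm z + 2) ^ q"
    if n: "n \<in> N" and z: "norm z \<le> real i" for n z
  proof -
    have hol: "(\<lambda>z. diff_op \<psi> x z - z ^ q) holomorphic_on UNIV" "(\<lambda>z. z ^ q) holomorphic_on UNIV"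
      by (intro holomorphic_intros hx)+
    have "diff_op (P n) (diff_op \<psi> x) z =
        diff_op (P n) (\<lambda>z. diff_op \<psi> x z - z ^ q) z + diff_op (P n) (\<lambda>z. z ^ q) z"
      using diff_op_add_right[OF hol, of "P n" z] by simp
    also have "norm \<dots> \<le> op_size (P n) * e + op_size (P n) * (norm z + 1) ^ q"
    proof (intro norm_triangle_le add_mono)
      show "norm (diff_op (P n) (\<lambda>z. diff_op \<psi> x z - z ^ q) z) \<le> op_size (P n) * e"
        by (rule norm_diff_op_le_cball[OF hol(1) z near])
      show "norm (diff_op (P n) (\<lambda>z. z ^ q) z) \<le> op_size (P n) * (norm z + 1) ^ q"
        by (rule norm_diff_op_le_cball[OF hol(2) order_refl]) (auto simp: norm_power intro: power_mono)
    qed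
    \<comment> \<open>The perturbation contributes at most \<open>1/2\<close> and the monomial at
      most half of the claimed bound, which is itself at least 1.\<close>
    also have "\<dots> \<le> 1 / 2 + 2 ^ q / 2 * (norm z + 1) ^ q"
    proof (intro add_mono mult_right_mono)
      have "op_size (P n) * e \<le> s * (1 / (2 * (s + 1)))"
        using op_le[OF n] s e by (intro mult_mono) (auto simp: e_def)
      also have "\<dots> \<le> 1 / 2" using s by (simp add: field_simps)
      finally show "op_size (P n) * e \<le> 1 / 2" .
      show "op_size (P n) \<le> 2 ^ q / 2" using op_le[OF n] q2(2) by simp
    qed auto
    also have "2 ^ q / 2 * (norm z + 1) ^ q = (2 * norm z + 2) ^ q / 2"
      by (simp add: power_mult_distrib[symmetric] algebra_simps)
    also have "1 / 2 + (2 * norm z + 2) ^ q / 2 \<le> (2 * norm z + 2) ^ q"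
      using one_le_power[of "2 * norm z + 2" q] norm_ge_zero[of z] by linarith
    finally show ?thesis .
  qed
  moreover have "norm (diff_op \<psi> x z - z ^ q) \<le> (1/2) ^ (i + 2)" if "norm z \<le> real i" for z
    using near[of z] that by (simp add: e_def)
  ultimately show ?thesis
    using tc deg by (intro exI[of _ q] exI[of _ \<psi>]) (auto simp: q_def)
qed

text \<open>Stage \<open>i\<close> chooses a triple: \<open>p i\<close> and \<open>\<phi> i\<close>
  are adapted to the earlier time sets \<open>N k\<close>, and afterwards \<open>N i\<close> is
  adapted to all polynomials up to \<open>\<phi> i\<close>.\<close>

lemma exists_perturbed_monomials:
  assumes x: "x \<in> hypercyclic_entire P"
  obtains p :: "nat \<Rightarrow> nat" and \<phi> :: "nat \<Rightarrow> complex poly" and N :: "nat \<Rightarrow> nat set" and c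
  where "perturbed_monomials (\<lambda>i. diff_op (\<phi> i) x) p"
    and "\<phi> 0 = [:c:]" and "c \<noteq> 0"
    and "\<forall>i. \<forall>n\<in>N i. n \<ge> 1"
    and "\<forall>i. \<forall>k<i. \<forall>n\<in>N k. \<forall>z. norm z \<le> real i \<longrightarrow>
      norm (diff_op (P n) (diff_op (\<phi> i) x) z) \<le> (2 * norm z + 2) ^ p i"
    and "\<forall>i a. (\<forall>k. norm (a k) \<le> real i + 1) \<and> 1 / (real i + 1) \<le> (\<Sum>k\<le>i. norm (a k)) \<longrightarrow>
      (\<forall>t\<le>i. \<exists>n\<in>N i. \<forall>z. norm z \<le> real i \<longrightarrow>
        norm ((\<Sum>k\<le>i. a k * diff_op (\<phi> k) (diff_op (P n) x) z) - diff_op (P t) x z)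
          \<le> 1 / (real i + 1))"
proof -
  have hx: "x holomorphic_on UNIV" using x by (rule hypercyclic_holomorphic)
  obtain q0 where q0: "taylor_coeff q0 x \<noteq> 0"
    using hypercyclic_taylor_coeff_nonzero[OF x] by blast
  \<comment> \<open>This factor normalises the coefficient of \<open>f 0\<close> at
    \<open>p 0 = q0\<close> to 1.\<close>
  define c where "c = 1 / taylor_coeff q0 x"
  have c: "c \<noteq> 0" using q0 by (simp add: c_def)
  define start :: "nat \<Rightarrow> complex poly \<Rightarrow> bool" where "start q \<psi> \<longleftrightarrow> q = q0 \<and> \<psi> = [:c:]" for q \<psi>
  define step where "step p \<phi> N i q \<psi> \<longleftrightarrow>
      (\<forall>k<i. p k < q \<and> degree (\<phi> k) < degree \<psi>) \<and>
      norm (taylor_coeff q (diff_op [:c:] x)) \<le> 1 / 4 \<and>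
      (\<forall>z. norm z \<le> real i \<longrightarrow> norm (diff_op \<psi> x z - z ^ q) \<le> (1/2) ^ (i + 2)) \<and>
      (\<forall>k<i. \<forall>n\<in>N k. \<forall>z. norm z \<le> real i \<longrightarrow>
        norm (diff_op (P n) (diff_op \<psi> x) z) \<le> (2 * norm z + 2) ^ q)"
    for p :: "nat \<Rightarrow> nat" and \<phi> :: "nat \<Rightarrow> complex poly" and N :: "nat \<Rightarrow> nat set" and i q \<psi>
  \<comment> \<open>The targets are the first orbit points. The bounds \<open>real i + 1\<close> and
    \<open>1 / (real i + 1)\<close> define sets that eventually contain every bounded nonzero
    sequence, and the added 1 keeps them meaningful at \<open>i = 0\<close>.\<close>
  define universal where "universal \<phi> i M \<longleftrightarrow> finite M \<and> (\<forall>n\<in>M. n \<ge> 1) \<and>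
      (\<forall>a. \<forall>g\<in>(\<lambda>t. diff_op (P t) x) ` {..i}. (\<forall>k. norm (a k) \<le> real i + 1) \<and>
          1 / (real i + 1) \<le> (\<Sum>k\<le>i. norm (a k)) \<longrightarrow>
        (\<exists>n\<in>M. \<forall>z. norm z \<le> real i \<longrightarrow>
          norm ((\<Sum>k\<le>i. a k * diff_op (\<phi> k) (diff_op (P n) x) z) - g z) \<le> 1 / (real i + 1)))"
    for \<phi> :: "nat \<Rightarrow> complex poly" and i and M :: "nat set"
  \<comment> \<open>The triple \<open>r\<close> under consideration is not yet a value of
    \<open>F\<close>, so its polynomial is spliced in at index \<open>i\<close>; for
    \<open>r = F i\<close> the spliced family agrees with the final one up to
    \<open>i\<close>.\<close>
  define admissible where "admissible F i r \<longleftrightarrow>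
      (if i = 0 then start (fst r) (fst (snd r))
       else step (\<lambda>k. fst (F k)) (\<lambda>k. fst (snd (F k))) (\<lambda>k. snd (snd (F k))) i (fst r) (fst (snd r))) \<and>
      universal (\<lambda>k. if k < i then fst (snd (F k)) else fst (snd r)) i (snd (snd r))"
    for F :: "nat \<Rightarrow> nat \<times> complex poly \<times> nat set" and i and r :: "nat \<times> complex poly \<times> nat set"
  have "\<exists>F. \<forall>i. admissible F i (F i)"
  \<comment> \<open>The first goal says that admissibility at \<open>i\<close> reads
    \<open>F\<close> only below \<open>i\<close>; the second is the existence of the next
    triple.\<close>
  proof (rule dependent_wellorder_choice)
    fix r :: "nat \<times> complex poly \<times> nat set" and F G :: "nat \<Rightarrow> nat \<times> complex poly \<times> nat set" and i
    assume eq: "\<And>y. y < i \<Longrightarrow> F y = G y"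
    have "(\<lambda>k. if k < i then fst (snd (F k)) else fst (snd r)) =
        (\<lambda>k. if k < i then fst (snd (G k)) else fst (snd r))"
      using eq by auto
    moreover have "step (\<lambda>k. fst (F k)) (\<lambda>k. fst (snd (F k))) (\<lambda>k. snd (snd (F k))) i q \<psi> \<longleftrightarrow>
        step (\<lambda>k. fst (G k)) (\<lambda>k. fst (snd (G k))) (\<lambda>k. snd (snd (G k))) i q \<psi>" for q \<psi>
      using eq by (simp add: step_def)
    ultimately show "admissible F i r = admissible G i r"
      by (simp add: admissible_def)
  next
    fix i and F :: "nat \<Rightarrow> nat \<times> complex poly \<times> nat set"
    assume IH: "\<And>y. y < i \<Longrightarrow> admissible F y (F y)"
    define \<phi> where "\<phi> = (\<lambda>k. fst (snd (F k)))"
    have deg: "degree (\<phi> j) < degree (\<phi> k)" if "j < k" "k < i" for j k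
      using IH[OF that(2)] that(1) by (auto simp: admissible_def step_def \<phi>_def)
    have \<phi>0: "\<phi> 0 = [:c:]" if "0 < i"
      using IH[OF that] by (simp add: admissible_def start_def \<phi>_def)
    have "\<exists>q \<psi>. if i = 0 then start q \<psi>
       else step (\<lambda>k. fst (F k)) \<phi> (\<lambda>k. snd (snd (F k))) i q \<psi>"
    proof (cases "i = 0")
      case False
      \<comment> \<open>The sums \<open>q1\<close> and \<open>d\<close> are crude common upper
        bounds for the earlier exponents and degrees.\<close>
      define q1 where "q1 = (\<Sum>k<i. fst (F k))"
      define d where "d = (\<Sum>k<i. degree (\<phi> k))"
      have le: "fst (F k) \<le> q1" "degree (\<phi> k) \<le> d" if "k < i" for k
        unfolding q1_def d_def using that by (auto intro!: member_le_sum)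
      have "finite (\<Union>k<i. snd (snd (F k)))"
        using IH by (auto simp: admissible_def universal_def)
      moreover have "diff_op [:c:] x holomorphic_on UNIV" using hx by (rule diff_op_holomorphic)
      ultimately obtain q \<psi> where q: "q1 < q" "d < degree \<psi>"
        "norm (taylor_coeff q (diff_op [:c:] x)) \<le> 1 / 4"
        "\<forall>z. norm z \<le> real i \<longrightarrow> norm (diff_op \<psi> x z - z ^ q) \<le> (1/2) ^ (i + 2)"
        "\<forall>n\<in>(\<Union>k<i. snd (snd (F k))). \<forall>z. norm z \<le> real i \<longrightarrow>
          norm (diff_op (P n) (diff_op \<psi> x) z) \<le> (2 * norm z + 2) ^ q"
        using exists_near_monomial[OF x] by meson
      have "step (\<lambda>k. fst (F k)) \<phi> (\<lambda>k. snd (snd (F k))) i q \<psi>"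
        unfolding step_def using q le by (fastforce intro: le_less_trans)
      with False show ?thesis by auto
    qed (auto simp: start_def)
    then obtain q \<psi> where q: "if i = 0 then start q \<psi>
       else step (\<lambda>k. fst (F k)) \<phi> (\<lambda>k. snd (snd (F k))) i q \<psi>" by blast
    define \<phi>' where "\<phi>' = (\<lambda>k. if k < i then \<phi> k else \<psi>)"
    have deg': "degree (\<phi>' j) < degree (\<phi>' k)" if "j < k" "k \<le> i" for j k
      using that deg[of j k] q by (auto simp: \<phi>'_def step_def split: if_splits)
    have "\<phi>' 0 \<noteq> 0"
      using \<phi>0 c q by (auto simp: \<phi>'_def start_def split: if_splits)
    moreover have "g holomorphic_on UNIV" if "g \<in> (\<lambda>t. diff_op (P t) x) ` {..i}" for g
      using that hx by (auto intro: diff_op_holomorphic)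
    ultimately have "\<exists>M. universal \<phi>' i M"
      unfolding universal_def
      by (intro finite_universal_times[where \<phi> = \<phi>' and i = i] x deg') auto
    then obtain M where "universal \<phi>' i M" by blast
    with q have "admissible F i (q, \<psi>, M)"
      unfolding admissible_def \<phi>'_def \<phi>_def fst_conv snd_conv by (rule conjI)
    then show "\<exists>r. admissible F i r" ..
  qed
  then obtain F where F: "\<And>i. admissible F i (F i)" by blast
  define p where "p = (\<lambda>k. fst (F k))"
  define \<phi> where "\<phi> = (\<lambda>k. fst (snd (F k)))"
  define N where "N = (\<lambda>k. snd (snd (F k)))"
  have start: "p 0 = q0" "\<phi> 0 = [:c:]"
    using F[of 0] by (auto simp: admissible_def start_def p_def \<phi>_def)
  have step: "step p \<phi> N i (p i) (\<phi> i)" if "i \<ge> 1" for i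
    using F[of i] that by (auto simp: admissible_def p_def \<phi>_def N_def)
  have universal: "universal \<phi> i (N i)" for i
  proof -
    have "universal (\<lambda>k. if k < i then \<phi> k else \<phi> i) i (N i)"
      using F[of i] unfolding admissible_def \<phi>_def N_def by (rule conjunct2)
    moreover have "(\<Sum>k\<le>i. a k * diff_op (if k < i then \<phi> k else \<phi> i) h z) =
        (\<Sum>k\<le>i. a k * diff_op (\<phi> k) h z)" for a h z
      by (intro sum.cong) (auto simp: not_less dest: le_antisym)
    ultimately show ?thesis unfolding universal_def by simp
  qed
  show ?thesis
  proof (rule that[of \<phi> p c N])
    show "perturbed_monomials (\<lambda>i. diff_op (\<phi> i) x) p"
    proof
      show "diff_op (\<phi> i) x holomorphic_on UNIV" for i using hx by (rule diff_op_holomorphic)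
      show "strict_mono p"
        using step unfolding step_def strict_mono_def by (metis One_nat_def Suc_leI not_gr_zero not_less_zero)
      show "norm (diff_op (\<phi> i) x z - z ^ p i) \<le> (1/2) ^ (i + 2)" if "i \<ge> 1" "norm z \<le> real i" for i z
        using step[OF that(1)] that(2) by (simp add: step_def)
      have "diff_op [:c:] x = (\<lambda>z. c * x z)" by (simp add: fun_eq_iff diff_op_pCons)
      moreover have "taylor_coeff q0 (\<lambda>z. c * x z) = c * taylor_coeff q0 x"
        by (simp add: taylor_coeff_def higher_deriv_cmult[of _ UNIV] hx)
      ultimately show "taylor_coeff (p 0) (diff_op (\<phi> 0) x) = 1"
        using q0 by (simp add: start c_def)
      show "norm (taylor_coeff (p k) (diff_op (\<phi> 0) x)) \<le> 1 / 4" if "k \<ge> 1" for k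
        using step[OF that] by (simp add: step_def start)
    qed
    show "\<phi> 0 = [:c:]" "c \<noteq> 0" by (fact start(2), fact c)
    show "\<forall>i. \<forall>n\<in>N i. n \<ge> 1"
      using universal by (simp add: universal_def)
    show "\<forall>i. \<forall>k<i. \<forall>n\<in>N k. \<forall>z. norm z \<le> real i \<longrightarrow>
        norm (diff_op (P n) (diff_op (\<phi> i) x) z) \<le> (2 * norm z + 2) ^ p i"
    proof (intro allI impI)
      fix i k :: nat assume "k < i"
      with step[of i] show "\<forall>n\<in>N k. \<forall>z. norm z \<le> real i \<longrightarrow>
          norm (diff_op (P n) (diff_op (\<phi> i) x) z) \<le> (2 * norm z + 2) ^ p i"
        by (simp add: step_def)
    qed
    show "\<forall>i a. (\<forall>k. norm (a k) \<le> real i + 1) \<and> 1 / (real i + 1) \<le> (\<Sum>k\<le>i. norm (a k)) \<longrightarrow>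
        (\<forall>t\<le>i. \<exists>n\<in>N i. \<forall>z. norm z \<le> real i \<longrightarrow>
          norm ((\<Sum>k\<le>i. a k * diff_op (\<phi> k) (diff_op (P n) x) z) - diff_op (P t) x z)
            \<le> 1 / (real i + 1))"
    proof (intro allI impI)
      fix i t :: nat and a :: "nat \<Rightarrow> complex"
      assume a: "(\<forall>k. norm (a k) \<le> real i + 1) \<and> 1 / (real i + 1) \<le> (\<Sum>k\<le>i. norm (a k))" and "t \<le> i"
      then have "diff_op (P t) x \<in> (\<lambda>t. diff_op (P t) x) ` {..i}" by simp
      with a universal[of i] show "\<exists>n\<in>N i. \<forall>z. norm z \<le> real i \<longrightarrow>
          norm ((\<Sum>k\<le>i. a k * diff_op (\<phi> k) (diff_op (P n) x) z) - diff_op (P t) x z)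
            \<le> 1 / (real i + 1)"
        unfolding universal_def by (elim conjE) (drule spec[of _ a], drule bspec, assumption, blast)
    qed
  qed
qed

section \<open>The closed subspace through a hypercyclic vector\<close>

lemma hypercyclic_pointwise_spaceable:
  "pointwise_spaceable fun_scale entire_space |UNIV :: real set| (hypercyclic_entire P)"
  unfolding pointwise_spaceable_def
proof
  fix x assume x: "x \<in> hypercyclic_entire P"
  have hx: "x holomorphic_on UNIV" using x by (rule hypercyclic_holomorphic)
  obtain p :: "nat \<Rightarrow> nat" and \<phi> N c where pm: "perturbed_monomials (\<lambda>i. diff_op (\<phi> i) x) p"
    and \<phi>0: "\<phi> 0 = [:c:]" "c \<noteq> 0"
    and N: "\<forall>i. \<forall>n\<in>N i. n \<ge> 1"
    and growth: "\<forall>i. \<forall>k<i. \<forall>n\<in>N k. \<forall>z. norm z \<le> real i \<longrightarrow>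
      norm (diff_op (P n) (diff_op (\<phi> i) x) z) \<le> (2 * norm z + 2) ^ p i"
    and universal: "\<forall>i a. (\<forall>k. norm (a k) \<le> real i + 1) \<and> 1 / (real i + 1) \<le> (\<Sum>k\<le>i. norm (a k)) \<longrightarrow>
      (\<forall>t\<le>i. \<exists>n\<in>N i. \<forall>z. norm z \<le> real i \<longrightarrow>
        norm ((\<Sum>k\<le>i. a k * diff_op (\<phi> k) (diff_op (P n) x) z) - diff_op (P t) x z)
          \<le> 1 / (real i + 1))"
    by (rule exists_perturbed_monomials[OF x]) (rule that)
  interpret perturbed_monomials "\<lambda>i. diff_op (\<phi> i) x" p by (fact pm)
  have "x \<in> comb ` coords"
  proof (rule image_eqI)
    \<comment> \<open>Since \<open>f 0\<close> is \<open>c\<close> times \<open>x\<close>, the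
      coordinate \<open>1 / c\<close> at index 0 reproduces \<open>x\<close>.\<close>
    define a where "a = (\<lambda>k::nat. if k = 0 then 1 / c else 0)"
    show "a \<in> coords"
      unfolding coords_def
    proof (intro CollectI allI impI)
      fix r :: real
      have "(\<lambda>k. norm (a k) * r ^ p k) sums (\<Sum>k\<in>{0}. norm (a k) * r ^ p k)"
        by (intro sums_finite) (auto simp: a_def)
      then show "summable (\<lambda>k. norm (a k) * r ^ p k)" by (rule sums_summable)
    qed
    have "(\<lambda>k. a k * diff_op (\<phi> k) x z) sums (\<Sum>k\<in>{0}. a k * diff_op (\<phi> k) x z)" for z
      by (intro sums_finite) (auto simp: a_def)
    then show "x = comb a"
      using \<phi>0 by (auto simp: comb_def fun_eq_iff a_def diff_op_pCons dest!: sums_unique)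
  qed
  moreover have "comb a \<in> hypercyclic_entire P" if a: "a \<in> coords" "a \<noteq> (\<lambda>k. 0)" for a
  proof (rule hypercyclic_if_orbit_approx[OF x comb_holomorphic[OF a(1)]])
    fix t :: nat and r e :: real
    assume "t \<ge> 1" and r: "r \<ge> 0" and e: "e > 0"
    obtain M where M: "\<And>k. norm (a k) \<le> M"
      using coords_bounded[OF a(1)] by (auto simp: bdd_above_def)
    obtain k0 where k0: "a k0 \<noteq> 0" using a(2) by auto
    have summ: "summable (\<lambda>k. norm (a k) * (2 * r + 2) ^ p k)"
      using a(1) r by (intro coordsD) auto
    obtain I where I: "\<And>n. n \<ge> I \<Longrightarrow> norm (\<Sum>k. norm (a (k + n)) * (2 * r + 2) ^ p (k + n)) < e / 2"
      using suminf_exist_split[OF half_gt_zero[OF e] summ] by blast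
    obtain i0 :: nat where i0: "max (max M r) (max (2 / e) (1 / norm (a k0))) \<le> real i0"
      using real_arch_simple by blast
    \<comment> \<open>This one index meets all demands: \<open>a\<close> satisfies the bounds of
      \<open>universal\<close>, the disc of radius \<open>r\<close> is covered, \<open>t\<close> is
      among the targets, the error \<open>1 / (real i + 1)\<close> is below \<open>e / 2\<close>,
      and the tail after \<open>i\<close> is small.\<close>
    define i where "i = i0 + I + k0 + t"
    have i: "M \<le> real i" "r \<le> real i" "2 / e \<le> real i" "1 / norm (a k0) \<le> real i"
      "k0 \<le> i" "t \<le> i" "I \<le> Suc i"
      using i0 by (auto simp: i_def)
    have bounded: "norm (a k) \<le> real i + 1" for k using M[of k] i(1) by linarith
    have "1 / (real i + 1) \<le> norm (a k0)"
    proof -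
      have "1 \<le> real i * norm (a k0)" using i(4) k0 by (simp add: divide_le_eq)
      also have "\<dots> \<le> (real i + 1) * norm (a k0)" by (simp add: distrib_right)
      finally show ?thesis by (simp add: divide_le_eq mult.commute)
    qed
    also have "norm (a k0) \<le> (\<Sum>k\<le>i. norm (a k))"
      using i(5) by (intro member_le_sum) auto
    finally have large: "1 / (real i + 1) \<le> (\<Sum>k\<le>i. norm (a k))" .
    obtain n where n: "n \<in> N i" "\<And>z. norm z \<le> real i \<Longrightarrow>
        norm ((\<Sum>k\<le>i. a k * diff_op (\<phi> k) (diff_op (P n) x) z) - diff_op (P t) x z)
          \<le> 1 / (real i + 1)"
      using universal bounded large i(6) by blast
    have "1 / (real i + 1) < e / 2"
    proof -
      have "2 \<le> real i * e" using i(3) e by (simp add: divide_le_eq)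
      then show ?thesis using e by (simp add: divide_less_eq algebra_simps)
    qed
    note small = this
    have "norm (diff_op (P n) (comb a) z - diff_op (P t) x z) < e" if z: "norm z \<le> r" for z
    proof -
      \<comment> \<open>The series is split after \<open>i\<close>. The head approximates the orbit
        point because \<open>n\<close> lies in \<open>N i\<close>; the tail is controlled by
        \<open>growth\<close>, since its indices exceed \<open>i\<close>.\<close>
      let ?u = "\<lambda>k. a k * diff_op (P n) (diff_op (\<phi> k) x) z"
      have "?u sums diff_op (P n) (comb a) z"
        using a(1) by (rule diff_op_comb_sums)
      then have "diff_op (P n) (comb a) z = (\<Sum>k. ?u (k + Suc i)) + (\<Sum>k<Suc i. ?u k)"
        using suminf_split_initial_segment[of ?u "Suc i"] by (simp add: sums_iff)
      also have "(\<Sum>k<Suc i. ?u k) = (\<Sum>k\<le>i. a k * diff_op (\<phi> k) (diff_op (P n) x) z)"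
        by (simp only: lessThan_Suc_atMost diff_op_commute[OF hx, of "P n"])
      finally have split: "diff_op (P n) (comb a) z - diff_op (P t) x z = (\<Sum>k. ?u (k + Suc i)) +
          ((\<Sum>k\<le>i. a k * diff_op (\<phi> k) (diff_op (P n) x) z) - diff_op (P t) x z)"
        by simp
      have "norm (\<Sum>k. ?u (k + Suc i)) \<le> (\<Sum>k. norm (a (k + Suc i)) * (2 * r + 2) ^ p (k + Suc i))"
      proof (rule norm_suminf_le)
        fix k
        have "norm (diff_op (P n) (diff_op (\<phi> (k + Suc i)) x) z) \<le> (2 * norm z + 2) ^ p (k + Suc i)"
          using n(1) z i(2) by (intro growth[rule_format, of i]) auto
        also have "\<dots> \<le> (2 * r + 2) ^ p (k + Suc i)"
          using z by (intro power_mono) auto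
        finally show "norm (?u (k + Suc i)) \<le> norm (a (k + Suc i)) * (2 * r + 2) ^ p (k + Suc i)"
          unfolding norm_mult by (rule mult_left_mono) simp
      next
        show "summable (\<lambda>k. norm (a (k + Suc i)) * (2 * r + 2) ^ p (k + Suc i))"
          using summable_ignore_initial_segment[OF summ, of "Suc i"] by simp
      qed
      also have "\<dots> < e / 2" using I[OF i(7)] by simp
      finally have "norm (\<Sum>k. ?u (k + Suc i)) < e / 2" .
      moreover have "norm ((\<Sum>k\<le>i. a k * diff_op (\<phi> k) (diff_op (P n) x) z) - diff_op (P t) x z) < e / 2"
        using n(2)[of z] z i(2) small by simp
      ultimately show ?thesis
        unfolding split by (intro norm_triangle_lt) linarith
    qed
    then show "\<exists>n\<ge>1. \<forall>z. norm z \<le> r \<longrightarrow> norm (diff_op (P n) (comb a) z - diff_op (P t) x z) < e"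
      using N n(1) by blast
  qed
  then have "comb ` coords \<subseteq> hypercyclic_entire P \<union> {0}"
    using comb_0 by (fastforce simp: zero_fun_def)
  ultimately show "\<exists>W. entire_vs.subspace W \<and> closedin entire_space W \<and>
      has_algebraic_dim fun_scale W |UNIV :: real set| \<and> x \<in> W \<and> W \<subseteq> hypercyclic_entire P \<union> {0}"
    using subspace_comb closedin_comb has_algebraic_dim_comb by blast
qed

theorem theorem4p2:
  fixes P :: "nat \<Rightarrow> complex poly"
  assumes nonconst: "\<And>n. n \<ge> 1 \<Longrightarrow> degree (P n) > 0"
    and valences_unbounded: "\<not> bdd_above ((\<lambda>n. valence (P n)) ` {1..})"
    and properties: "property_P P \<or> property_Q P \<or> property_R P"
  shows "pointwise_spaceable fun_scale entire_space |UNIV :: real set|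
           (hypercyclic_vectors entire_space entire_space (\<lambda>n. diff_op (P n)))"
  by (rule hypercyclic_pointwise_spaceable)

end
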